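(* Let $(X,d)$ be a metric space, let $\mathcal{B}$ be a bornology on $X$ with a closed base, and let $F\in (C(X),\tau_{\mathcal{B}})^*$. Then there exist a closed set $B\in\mathcal{B}$ and a measure $\mu\in\mathscr{M}_{\mathcal{B}}(X)$ supported on $B$ such that $F=H_\mu\circ p_B+F\circ q_B$, that is, $F(f)=\int_X f\,d\mu$ for all $f\in C(X)_{fin}^B$. Moreover, $\|\mu\|=\sup\{|F(f)|: f\in C(X),\ \|f\|_\infty\le 1\}$.
   Context: $C(X)$ is the real vector space of continuous functions $X\to\mathbb{R}$, and $\|f\|_\infty=\sup_{x\in X}|f(x)|$. A bornology $\mathcal{B}$ on $X$ is a collection of non-empty subsets of $X$ that covers $X$ and is closed under finite unions and under taking (non-empty) subsets of its members; it has a closed base if every member of $\mathcal{B}$ is contained in a closed member of $\mathcal{B}$. For $B\in\mathcal{B}$ let $\rho_B(f)=\sup_{x\in B}|f(x)|\in[0,\infty]$. The topology $\tau_{\mathcal{B}}$ of uniform convergence on $\mathcal{B}$ is the translation-invariant topology on $C(X)$ for which the sets $\rho_B^{-1}([0,r))$ ($B\in\mathcal{B}$, $r>0$) form a neighborhood base at $0$. $(C(X),\tau_{\mathcal{B}})^*$ is the space of all continuous linear functionals $C(X)\to\mathbb{R}$. $\mathscr{M}_{\mathcal{B}}(X)$ is the set of all closed regular, finite (signed) Borel measures $\mu$ on $X$ supported on $\mathcal{B}$, i.e. for which there is a closed $B\in\mathcal{B}$ with $|\mu|(X\setminus B)=0$ (then $\mu$ is said to be supported on $B$); closed regular means that for every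 Borel set $A$ and $\epsilon>0$ there are a closed $C$ and an open $U$ with $C\subseteq A\subseteq U$ and $|\mu|(U\setminus C)<\epsilon$. $\|\mu\|=|\mu|(X)$ is the total variation. $C(X)_{fin}^B=\{f\in C(X):\rho_B(f)<\infty\}$. $M_B$ is an algebraic complement, $C(X)=C(X)_{fin}^B\oplus M_B$, and $p_B$, $q_B$ are the corresponding projections of $C(X)$ onto $C(X)_{fin}^B$ and $M_B$. For $\mu$ supported on $B$, $H_\mu(f)=\int_X f\,d\mu$ for $f\in C(X)_{fin}^B$.
   Formalization: "Borel measure" is taken as a finitely additive signed measure on the algebra generated by the closed sets, with the Dunford–Schwartz integral; for countably additive measures the claim fails (X=ℕ discrete, all non-empty subsets, F extending a free ultrafilter limit). *)

theory Defs
  imports "HOL-Analysis.Analysis"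
begin

section \<open>The space of continuous functions and the topology of a bornology\<close>

text \<open>
  The metric space is a type of class metric_space; a general topological space is enough for
  all the definitions below. Elements of the space of continuous functions are plain functions.
\<close>

definition cont_funs :: "('a::topological_space \<Rightarrow> real) set"
  where "cont_funs = {f. continuous_on UNIV f}"

definition bornology :: "'a set set \<Rightarrow> bool"
  where "bornology \<B> \<longleftrightarrow>
    {} \<notin> \<B> \<and> \<Union>\<B> = UNIV \<and>
    (\<forall>A\<in>\<B>. \<forall>B\<in>\<B>. A \<union> B \<in> \<B>) \<and>
    (\<forall>B\<in>\<B>. \<forall>A. A \<noteq> {} \<and> A \<subseteq> B \<longrightarrow> A \<in> \<B>)"

definition has_closed_base :: "'a::topological_space set set \<Rightarrow> bool"
  where "has_closed_base \<B> \<longleftrightarrow> (\<forall>B\<in>\<B>. \<exists>C\<in>\<B>. closed C \<and> B \<subseteq> C)"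

definition \<rho> :: "'a set \<Rightarrow> ('a \<Rightarrow> real) \<Rightarrow> ennreal"
  where "\<rho> B f = (SUP x\<in>B. ennreal \<bar>f x\<bar>)"

text \<open>
  The sup norm may be infinite on an unbounded continuous function.
\<close>

abbreviation sup_norm :: "('a \<Rightarrow> real) \<Rightarrow> ennreal"
  where "sup_norm f \<equiv> \<rho> UNIV f"

definition tau :: "'a::topological_space set set \<Rightarrow> ('a \<Rightarrow> real) topology"
  where "tau \<B> = topology (\<lambda>U. U \<subseteq> cont_funs \<and>
    (\<forall>f\<in>U. \<exists>B\<in>\<B>. \<exists>r>0. {g\<in>cont_funs. \<rho> B (\<lambda>x. g x - f x) < ennreal r} \<subseteq> U))"

definition dual :: "'a::topological_space set set \<Rightarrow> (('a \<Rightarrow> real) \<Rightarrow> real) set"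
  where "dual \<B> = {F. continuous_map (tau \<B>) euclideanreal F \<and>
    (\<forall>f\<in>cont_funs. \<forall>g\<in>cont_funs. F (\<lambda>x. f x + g x) = F f + F g) \<and>
    (\<forall>c. \<forall>f\<in>cont_funs. F (\<lambda>x. c * f x) = c * F f)}"

text \<open>
  The predicate inside \<^const>\<open>tau\<close> is a topology, and balls are neighbourhoods of their centres.
\<close>

lemma \<rho>_mono: "A \<subseteq> B \<Longrightarrow> \<rho> A f \<le> \<rho> B f"
  unfolding \<rho>_def by (rule SUP_subset_mono) auto

lemma \<rho>_triangle: "\<rho> B (\<lambda>x. h x - f x) \<le> \<rho> B (\<lambda>x. h x - g x) + \<rho> B (\<lambda>x. g x - f x)"
  unfolding \<rho>_def
proof (rule SUP_least)
  fix x assume x: "x \<in> B"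
  have "ennreal \<bar>h x - f x\<bar> \<le> ennreal (\<bar>h x - g x\<bar> + \<bar>g x - f x\<bar>)"
    by (rule ennreal_leI) linarith
  also have "\<dots> = ennreal \<bar>h x - g x\<bar> + ennreal \<bar>g x - f x\<bar>"
    by simp
  also have "\<dots> \<le> (SUP x\<in>B. ennreal \<bar>h x - g x\<bar>) + (SUP x\<in>B. ennreal \<bar>g x - f x\<bar>)"
    using x by (intro add_mono SUP_upper)
  finally show "ennreal \<bar>h x - f x\<bar> \<le>
    (SUP x\<in>B. ennreal \<bar>h x - g x\<bar>) + (SUP x\<in>B. ennreal \<bar>g x - f x\<bar>)" .
qed

lemma openin_tau:
  assumes "bornology \<B>"
  shows "openin (tau \<B>) U \<longleftrightarrow> U \<subseteq> cont_funs \<and>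
    (\<forall>f\<in>U. \<exists>B\<in>\<B>. \<exists>r>0. {g\<in>cont_funs. \<rho> B (\<lambda>x. g x - f x) < ennreal r} \<subseteq> U)"
proof -
  let ?P = "\<lambda>U. U \<subseteq> cont_funs \<and>
    (\<forall>f\<in>U. \<exists>B\<in>\<B>. \<exists>r>0. {g\<in>cont_funs. \<rho> B (\<lambda>x. g x - f x) < ennreal r} \<subseteq> U)"
  have "istopology ?P"
    unfolding istopology_def
  proof (intro conjI allI impI)
    fix S T assume S: "?P S" and T: "?P T"
    show "S \<inter> T \<subseteq> cont_funs" using S by blast
    show "\<forall>f\<in>S \<inter> T. \<exists>B\<in>\<B>. \<exists>r>0. {g\<in>cont_funs. \<rho> B (\<lambda>x. g x - f x) < ennreal r} \<subseteq> S \<inter> T"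
    proof
      fix f assume f: "f \<in> S \<inter> T"
      obtain A r where A: "A \<in> \<B>" "r > 0"
        "{g\<in>cont_funs. \<rho> A (\<lambda>x. g x - f x) < ennreal r} \<subseteq> S"
        using S f by blast
      obtain B s where B: "B \<in> \<B>" "s > 0"
        "{g\<in>cont_funs. \<rho> B (\<lambda>x. g x - f x) < ennreal s} \<subseteq> T"
        using T f by blast
      have "A \<union> B \<in> \<B>" using assms A(1) B(1) by (auto simp: bornology_def)
      moreover have "min r s > 0" using A(2) B(2) by simp
      moreover have "{g\<in>cont_funs. \<rho> (A \<union> B) (\<lambda>x. g x - f x) < ennreal (min r s)} \<subseteq> S \<inter> T"
      proof
        fix g assume g: "g \<in> {g\<in>cont_funs. \<rho> (A \<union> B) (\<lambda>x. g x - f x) < ennreal (min r s)}"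
        have "ennreal (min r s) \<le> ennreal r" "ennreal (min r s) \<le> ennreal s"
          by (simp_all add: ennreal_leI)
        moreover have "\<rho> A (\<lambda>x. g x - f x) \<le> \<rho> (A \<union> B) (\<lambda>x. g x - f x)"
          "\<rho> B (\<lambda>x. g x - f x) \<le> \<rho> (A \<union> B) (\<lambda>x. g x - f x)"
          by (auto intro: \<rho>_mono)
        ultimately have "\<rho> A (\<lambda>x. g x - f x) < ennreal r" "\<rho> B (\<lambda>x. g x - f x) < ennreal s"
          using g by (auto intro: le_less_trans less_le_trans)
        then show "g \<in> S \<inter> T" using A(3) B(3) g by blast
      qed
      ultimately show "\<exists>B\<in>\<B>. \<exists>r>0. {g\<in>cont_funs. \<rho> B (\<lambda>x. g x - f x) < ennreal r} \<subseteq> S \<inter> T"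
        by blast
    qed
  next
    fix \<K> assume K: "\<forall>K\<in>\<K>. ?P K"
    show "\<Union>\<K> \<subseteq> cont_funs" using K by blast
    show "\<forall>f\<in>\<Union>\<K>. \<exists>B\<in>\<B>. \<exists>r>0. {g\<in>cont_funs. \<rho> B (\<lambda>x. g x - f x) < ennreal r} \<subseteq> \<Union>\<K>"
    proof
      fix f assume "f \<in> \<Union>\<K>"
      then obtain K where "K \<in> \<K>" "f \<in> K" by blast
      moreover from this K obtain B r where "B \<in> \<B>" "r > 0"
        "{g\<in>cont_funs. \<rho> B (\<lambda>x. g x - f x) < ennreal r} \<subseteq> K" by blast
      ultimately show "\<exists>B\<in>\<B>. \<exists>r>0. {g\<in>cont_funs. \<rho> B (\<lambda>x. g x - f x) < ennreal r} \<subseteq> \<Union>\<K>"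
        by blast
    qed
  qed
  then show ?thesis by (simp add: tau_def topology_inverse')
qed

lemma topspace_tau:
  assumes "bornology (\<B> :: 'a::topological_space set set)"
  shows "topspace (tau \<B>) = cont_funs"
proof -
  obtain B where "B \<in> \<B>" using assms by (auto simp: bornology_def)
  then have "openin (tau \<B>) cont_funs"
    unfolding openin_tau[OF assms] by (auto intro!: exI[of _ "1::real"])
  moreover have "topspace (tau \<B>) \<subseteq> cont_funs"
    using openin_tau[OF assms] openin_topspace by blast
  ultimately show ?thesis using openin_subset by blast
qed

lemma openin_tau_ball:
  assumes "bornology \<B>" "B \<in> \<B>" "f \<in> cont_funs" "r > 0"
  shows "\<exists>U. openin (tau \<B>) U \<and> f \<in> U \<and>
    U \<subseteq> {g\<in>cont_funs. \<rho> B (\<lambda>x. g x - f x) < ennreal r}"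
proof -
  let ?U = "{g\<in>cont_funs. \<exists>s>0. \<exists>t>0. s + t = r \<and> \<rho> B (\<lambda>x. g x - f x) \<le> ennreal s}"
  have B: "B \<noteq> {}" using assms by (auto simp: bornology_def)
  have "openin (tau \<B>) ?U"
    unfolding openin_tau[OF assms(1)]
  proof (intro conjI ballI)
    fix g assume "g \<in> ?U"
    then obtain s t where st: "s > 0" "t > 0" "s + t = r" "\<rho> B (\<lambda>x. g x - f x) \<le> ennreal s"
      by blast
    have "{h\<in>cont_funs. \<rho> B (\<lambda>x. h x - g x) < ennreal (t / 2)} \<subseteq> ?U"
    proof
      fix h assume h: "h \<in> {h\<in>cont_funs. \<rho> B (\<lambda>x. h x - g x) < ennreal (t / 2)}"
      have "\<rho> B (\<lambda>x. h x - f x) \<le> ennreal (t / 2) + ennreal s"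
        using h by (intro order_trans[OF \<rho>_triangle[of B h f g]] add_mono st(4)) auto
      also have "\<dots> = ennreal (t / 2 + s)" using st by simp
      finally have "\<rho> B (\<lambda>x. h x - f x) \<le> ennreal (t / 2 + s)" .
      moreover have "t / 2 + s > 0" "t / 2 > 0" "(t / 2 + s) + t / 2 = r" using st by auto
      ultimately show "h \<in> ?U" using h by blast
    qed
    moreover have "t / 2 > 0" using st by simp
    ultimately show "\<exists>B\<in>\<B>. \<exists>r>0. {h\<in>cont_funs. \<rho> B (\<lambda>x. h x - g x) < ennreal r} \<subseteq> ?U"
      using assms(2) by blast
  qed auto
  moreover have "f \<in> ?U"
  proof -
    have "\<rho> B (\<lambda>x. f x - f x) \<le> ennreal (r / 2)" using B by (simp add: \<rho>_def)
    moreover have "r / 2 > 0" "r / 2 + r / 2 = r" using assms(4) by auto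
    ultimately show ?thesis using assms(3) by blast
  qed
  moreover have "?U \<subseteq> {g\<in>cont_funs. \<rho> B (\<lambda>x. g x - f x) < ennreal r}"
    by (auto intro!: le_less_trans[where y="ennreal _"] ennreal_lessI)
  ultimately show ?thesis by blast
qed


section \<open>Functions bounded on a set and algebraic complements\<close>

definition cont_fin :: "'a::topological_space set \<Rightarrow> ('a \<Rightarrow> real) set"
  where "cont_fin B = {f\<in>cont_funs. \<rho> B f < \<infinity>}"

definition lin_subspace :: "('a \<Rightarrow> real) set \<Rightarrow> bool"
  where "lin_subspace W \<longleftrightarrow> (\<lambda>x. 0) \<in> W \<and>
    (\<forall>f\<in>W. \<forall>g\<in>W. (\<lambda>x. f x + g x) \<in> W) \<and> (\<forall>c. \<forall>f\<in>W. (\<lambda>x. c * f x) \<in> W)"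

definition direct_sum_of :: "('a \<Rightarrow> real) set \<Rightarrow> ('a \<Rightarrow> real) set \<Rightarrow> ('a \<Rightarrow> real) set \<Rightarrow> bool"
  where "direct_sum_of V U W \<longleftrightarrow> lin_subspace U \<and> lin_subspace W \<and>
    V = {(\<lambda>x. u x + w x) | u w. u \<in> U \<and> w \<in> W} \<and> U \<inter> W = {\<lambda>x. 0}"

text \<open>The projection onto U along W.\<close>

definition proj_along :: "('a \<Rightarrow> real) set \<Rightarrow> ('a \<Rightarrow> real) set \<Rightarrow> ('a \<Rightarrow> real) \<Rightarrow> ('a \<Rightarrow> real)"
  where "proj_along U W f = (THE u. u \<in> U \<and> (\<exists>w\<in>W. f = (\<lambda>x. u x + w x)))"


section \<open>Closed regular finite Borel measures\<close>

text \<open>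
  As usual when dual spaces of spaces of bounded continuous functions on noncompact spaces are
  represented by closed regular measures (Dunford and Schwartz, Linear Operators I, IV.6), a
  finite signed Borel measure is a finitely additive real-valued set function of bounded
  variation on the algebra (not sigma-algebra) generated by the closed sets. The
  representation is false for the two other natural readings. Countable additivity fails already
  for the discrete space of natural numbers with the bornology of all nonempty subsets: there a
  linear extension of an ultrafilter limit to all functions is a continuous functional.
  Finite additivity on the Borel sigma-algebra fails on the real line with the bornology of all
  nonempty subsets, for the functional given by a remote point of the Stone-Cech
  compactification: a closed subset of the rationals or of the irrationals is nowhere dense, so
  that the approximation required by closed regularity is impossible for the rationals.
  Also, closed regularity is automatic for finite countably additive Borel measures on metric
  spaces, and is a restriction only for finitely additive ones.
\<close>

definition borel_algebra :: "'a::topological_space set set"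
  where "borel_algebra = algebra UNIV hull {C. closed C}"

definition variation :: "('a::topological_space set \<Rightarrow> real) \<Rightarrow> 'a set \<Rightarrow> ennreal"
  where "variation \<mu> A =
    (SUP P\<in>{P. finite P \<and> P \<subseteq> borel_algebra \<and> disjoint P \<and> \<Union>P \<subseteq> A}. \<Sum>E\<in>P. ennreal \<bar>\<mu> E\<bar>)"

definition supported_on :: "('a::topological_space set \<Rightarrow> real) \<Rightarrow> 'a set \<Rightarrow> bool"
  where "supported_on \<mu> B \<longleftrightarrow> variation \<mu> (UNIV - B) = 0"

definition closed_regular :: "('a::topological_space set \<Rightarrow> real) \<Rightarrow> bool"
  where "closed_regular \<mu> \<longleftrightarrow> (\<forall>A\<in>borel_algebra. \<forall>\<epsilon>>0. \<exists>C U. closed C \<and> open U \<and>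
    C \<subseteq> A \<and> A \<subseteq> U \<and> variation \<mu> (U - C) < ennreal \<epsilon>)"

text \<open>The values of such a measure outside \<^const>\<open>borel_algebra\<close> are irrelevant.\<close>

definition bornological_measures ::
    "'a::topological_space set set \<Rightarrow> ('a set \<Rightarrow> real) set"
  where "bornological_measures \<B> = {\<mu>.
    Measure_Space.additive borel_algebra \<mu> \<and> variation \<mu> UNIV < \<infinity> \<and> closed_regular \<mu> \<and>
    (\<exists>B\<in>\<B>. closed B \<and> supported_on \<mu> B)}"


section \<open>The Dunford-Schwartz integral\<close>

text \<open>
  The integral with respect to a finitely additive measure (Dunford and Schwartz, III.2): a
  function is integrable if it is the limit in measure of a sequence of simple functions that is
  Cauchy in mean, and its integral is the limit of the integrals of the simple functions.
\<close>

definition simple_fun :: "('a::topological_space \<Rightarrow> real) \<Rightarrow> bool"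
  where "simple_fun s \<longleftrightarrow> finite (range s) \<and> (\<forall>y. s -` {y} \<in> borel_algebra)"

definition simple_int :: "('a set \<Rightarrow> real) \<Rightarrow> ('a \<Rightarrow> real) \<Rightarrow> real"
  where "simple_int \<mu> s = (\<Sum>y\<in>range s. y * \<mu> (s -` {y}))"

definition outer_variation :: "('a::topological_space set \<Rightarrow> real) \<Rightarrow> 'a set \<Rightarrow> ennreal"
  where "outer_variation \<mu> E = (INF A\<in>{A\<in>borel_algebra. E \<subseteq> A}. variation \<mu> A)"

definition has_ds_integral ::
    "('a::topological_space set \<Rightarrow> real) \<Rightarrow> ('a \<Rightarrow> real) \<Rightarrow> real \<Rightarrow> bool"
  where "has_ds_integral \<mu> f I \<longleftrightarrow> (\<exists>s :: nat \<Rightarrow> 'a \<Rightarrow> real.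
    (\<forall>n. simple_fun (s n)) \<and>
    (\<forall>\<epsilon>>0. (\<lambda>n. outer_variation \<mu> {x. \<bar>s n x - f x\<bar> > \<epsilon>}) \<longlonglongrightarrow> 0) \<and>
    (\<forall>\<epsilon>>0. \<exists>N. \<forall>m\<ge>N. \<forall>n\<ge>N.
      simple_int (\<lambda>A. enn2real (variation \<mu> A)) (\<lambda>x. \<bar>s m x - s n x\<bar>) < \<epsilon>) \<and>
    (\<lambda>n. simple_int \<mu> (s n)) \<longlonglongrightarrow> I)"

text \<open>
  The functional H, meaningful on \<^term>\<open>cont_fin B\<close> when the measure is supported on B; the
  integral over the whole space exists although f may be unbounded outside B.
\<close>

definition H :: "('a::topological_space set \<Rightarrow> real) \<Rightarrow> ('a \<Rightarrow> real) \<Rightarrow> real"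
  where "H \<mu> f = (THE I. has_ds_integral \<mu> f I)"

end

theory Submission
  imports Defs
begin

text \<open>
  Continuity at \<open>0\<close> for the topology of uniform convergence on the bornology means that
  \<open>\<bar>F f\<bar> \<le> K * c\<close> whenever \<open>\<bar>f\<bar> \<le> c\<close> on one closed member \<open>B\<close> of the bornology
  (\<open>dual_bounded\<close>). Hence \<open>F f\<close> depends only on the restriction of \<open>f\<close> to \<open>B\<close>, a function bounded
  on \<open>B\<close> may be truncated to a bounded function without changing the value of \<open>F\<close>, and everything
  reduces to the representation of a bounded functional on the bounded continuous functions.

  For such a functional \<open>V f = sup {F g. \<bar>g\<bar> \<le> f}\<close> is additive and positively homogeneous on the
  nonnegative functions, because a function with \<open>\<bar>g\<bar> \<le> f1 + f2\<close> splits into functions dominated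
  by \<open>f1\<close> and \<open>f2\<close>. So \<open>F\<close> is the difference of the positive functionals \<open>P = (V + F) / 2\<close> and
  \<open>N = (V - F) / 2\<close>, and \<open>P 1 + N 1 = V 1\<close> is the norm of \<open>F\<close>; this makes the decomposition minimal
  and is the source of the norm equality.

  A positive functional \<open>L\<close> gives a content: a closed set \<open>K\<close> gets the infimum of the \<open>L f\<close> with
  \<open>f \<ge> 1\<close> on \<open>K\<close>, an arbitrary set the supremum over its closed subsets. By normality of the
  space this inner content is superadditive, and a direct estimate shows that closed
  sets split every set additively (\<open>closed_content_tight\<close>). They therefore belong to the algebra
  of Caratheodory-measurable sets, on which the inner content is additive; inner regularity holds by
  construction and outer regularity by taking complements. The content is tied to \<open>L\<close> only through
  two inequalities for closed sets, and slicing a function into layers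
  of height \<open>\<delta>\<close> turns these into \<open>\<bar>\<integral>f - L f\<bar> \<le> \<delta> * \<nu> UNIV\<close> for an explicit simple
  function within \<open>\<delta>\<close> of \<open>f\<close>.

  The measure is the difference of the contents of \<open>P\<close> and \<open>N\<close>. Its variation is at
  most \<open>P 1 + N 1\<close>, and at least the norm of \<open>F\<close> since \<open>F\<close> is integration. It vanishes off \<open>B\<close> because
  \<open>P\<close> and \<open>N\<close> vanish on functions that are \<open>0\<close> on \<open>B\<close>. Finally the functional \<open>H\<close>, a definite
  description, is only determined once the integral is known to be unique
  (\<open>has_ds_integral_unique\<close>), which requires the variation itself to be additive.
\<close>

section \<open>The algebra generated by the closed sets\<close>

lemma algebra_borel_algebra: "algebra UNIV (borel_algebra :: 'a::topological_space set set)"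
  unfolding borel_algebra_def
  by (rule hull_in) (fastforce simp: algebra_iff_Un)

interpretation borel_algebra: algebra UNIV "borel_algebra :: 'a::topological_space set set"
  by (rule algebra_borel_algebra)

lemma closed_in_borel_algebra: "closed C \<Longrightarrow> C \<in> borel_algebra"
  unfolding borel_algebra_def by (rule hull_inc) simp

lemma open_in_borel_algebra: "open U \<Longrightarrow> U \<in> borel_algebra"
  using borel_algebra.compl_sets[OF closed_in_borel_algebra[of "- U"]]
  by (simp add: Compl_eq_Diff_UNIV[symmetric] closed_def)

section \<open>Variation of additive set functions\<close>

lemma additive_empty:
  fixes \<mu> :: "'a::topological_space set \<Rightarrow> real"
  assumes "Measure_Space.additive borel_algebra \<mu>"
  shows "\<mu> {} = 0"
  using additiveD[OF assms, of "{}" "{}"] by simp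

lemma additive_Diff:
  fixes \<mu> :: "'a::topological_space set \<Rightarrow> real"
  assumes "Measure_Space.additive borel_algebra \<mu>"
    and "A \<in> borel_algebra" "B \<in> borel_algebra" "A \<subseteq> B"
  shows "\<mu> (B - A) = \<mu> B - \<mu> A"
  using additiveD[OF assms(1), of A "B - A"] assms(2-4) by (simp add: Un_absorb1 borel_algebra.Diff)

lemma additive_Union_image:
  fixes \<mu> :: "'a::topological_space set \<Rightarrow> real"
  assumes "Measure_Space.additive borel_algebra \<mu>"
    and "finite I" "\<And>i. i \<in> I \<Longrightarrow> A i \<in> borel_algebra" "disjoint_family_on A I"
  shows "\<mu> (\<Union>i\<in>I. A i) = (\<Sum>i\<in>I. \<mu> (A i))"
  using assms(2-4)
proof (induction I rule: finite_induct)
  case empty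
  then show ?case using additive_empty[OF assms(1)] by simp
next
  case (insert i I)
  have "A i \<inter> (\<Union>j\<in>I. A j) = {}"
    using insert.hyps insert.prems by (fastforce simp: disjoint_family_on_def)
  moreover have "(\<Union>j\<in>I. A j) \<in> borel_algebra"
    using insert by (intro borel_algebra.finite_UN) auto
  ultimately have "\<mu> (A i \<union> (\<Union>j\<in>I. A j)) = \<mu> (A i) + \<mu> (\<Union>j\<in>I. A j)"
    using insert.prems by (intro additiveD[OF assms(1)]) auto
  then show ?case using insert disjoint_family_on_mono[OF subset_insertI insert.prems(2)] by simp
qed

lemma abs_le_variation: "A \<in> borel_algebra \<Longrightarrow> ennreal \<bar>\<mu> A\<bar> \<le> variation \<mu> A"
  unfolding variation_def by (rule SUP_upper2[of "{A}"]) auto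

lemma variation_mono: "A \<subseteq> B \<Longrightarrow> variation \<mu> A \<le> variation \<mu> B"
  unfolding variation_def by (rule SUP_subset_mono) auto

text \<open>
  Cutting every member of a disjoint family along \<open>A\<close> yields two disjoint families. Distinct members
  may be cut to the same set, but then this set is empty and has measure \<open>0\<close>, so that the sums can be
  reindexed.
\<close>

lemma variation_subadditive:
  assumes add: "Measure_Space.additive borel_algebra \<mu>" and A: "A \<in> borel_algebra"
  shows "variation \<mu> E \<le> variation \<mu> (E \<inter> A) + variation \<mu> (E - A)"
  unfolding variation_def[of \<mu> E]
proof (rule SUP_least)
  fix P assume P: "P \<in> {P. finite P \<and> P \<subseteq> borel_algebra \<and> disjoint P \<and> \<Union>P \<subseteq> E}"
  have split: "ennreal \<bar>\<mu> D\<bar> \<le> ennreal \<bar>\<mu> (D \<inter> A)\<bar> + ennreal \<bar>\<mu> (D - A)\<bar>" if "D \<in> P" for D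
  proof -
    have "D \<in> borel_algebra" using that P by auto
    then have "\<mu> D = \<mu> (D \<inter> A) + \<mu> (D - A)"
      using additiveD[OF add, of "D \<inter> A" "D - A"] A by (auto simp: Int_Diff_Un)
    then show ?thesis by (simp flip: ennreal_plus add: ennreal_leI)
  qed
  have part: "(\<Sum>D\<in>P. ennreal \<bar>\<mu> (h D)\<bar>) \<le> variation \<mu> (h E)"
    if h: "\<And>D. D \<in> P \<Longrightarrow> h D \<in> borel_algebra" "\<And>D. h D \<subseteq> D" "\<And>D. D \<subseteq> E \<Longrightarrow> h D \<subseteq> h E" for h
  proof -
    have disj: "h D \<inter> h D' = {}" if "D \<in> P" "D' \<in> P" "D \<noteq> D'" for D D'
    proof -
      have "D \<inter> D' = {}" using P that disjointD[of P D D'] by simp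
      then show ?thesis using h(2)[of D] h(2)[of D'] by blast
    qed
    have null: "ennreal \<bar>\<mu> (h D)\<bar> = 0" if "D \<in> P" "D' \<in> P" "D \<noteq> D'" "h D = h D'" for D D'
      using disj[OF that(1-3)] that(4) additive_empty[OF add] by simp
    have "finite P" using P by blast
    then have "(\<Sum>D\<in>h ` P. ennreal \<bar>\<mu> D\<bar>) = (\<Sum>D\<in>P. ennreal \<bar>\<mu> (h D)\<bar>)"
      by (rule sum.reindex_nontrivial[where h=h and g="\<lambda>D. ennreal \<bar>\<mu> D\<bar>", unfolded o_def]) (rule null)
    then have "(\<Sum>D\<in>P. ennreal \<bar>\<mu> (h D)\<bar>) = (\<Sum>D\<in>h ` P. ennreal \<bar>\<mu> D\<bar>)" by simp
    also have "\<dots> \<le> variation \<mu> (h E)"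
      unfolding variation_def
    proof (rule SUP_upper)
      have "disjoint (h ` P)"
      proof (rule disjointI)
        fix a b assume "a \<in> h ` P" "b \<in> h ` P" "a \<noteq> b"
        then obtain D D' where "D \<in> P" "D' \<in> P" "a = h D" "b = h D'" "D \<noteq> D'" by blast
        then show "a \<inter> b = {}" using disj by simp
      qed
      moreover have "h ` P \<subseteq> borel_algebra" using h(1) by blast
      moreover have "h D \<subseteq> h E" if "D \<in> P" for D using P that by (intro h(3)) blast
      then have "\<Union>(h ` P) \<subseteq> h E" by blast
      ultimately show "h ` P \<in> {P. finite P \<and> P \<subseteq> borel_algebra \<and> disjoint P \<and> \<Union>P \<subseteq> h E}"
        using \<open>finite P\<close> by blast
    qed
    finally show ?thesis .
  qed
  have "(\<Sum>D\<in>P. ennreal \<bar>\<mu> D\<bar>) \<le> (\<Sum>D\<in>P. ennreal \<bar>\<mu> (D \<inter> A)\<bar> + ennreal \<bar>\<mu> (D - A)\<bar>)"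
    by (intro sum_mono split)
  also have "\<dots> \<le> variation \<mu> (E \<inter> A) + variation \<mu> (E - A)"
    unfolding sum.distrib using P A by (intro add_mono part) auto
  finally show "(\<Sum>D\<in>P. ennreal \<bar>\<mu> D\<bar>) \<le> variation \<mu> (E \<inter> A) + variation \<mu> (E - A)" .
qed

lemma SUP_add_SUP_le:
  fixes f :: "'i \<Rightarrow> ennreal" and g :: "'j \<Rightarrow> ennreal"
  assumes "I \<noteq> {}" "J \<noteq> {}" "\<And>i j. i \<in> I \<Longrightarrow> j \<in> J \<Longrightarrow> f i + g j \<le> c"
  shows "(SUP i\<in>I. f i) + (SUP j\<in>J. g j) \<le> c"
proof -
  have "f i + (SUP j\<in>J. g j) \<le> c" if "i \<in> I" for i
    using assms that by (simp add: ennreal_SUP_add_right SUP_le_iff)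
  then show ?thesis
    using assms(1) by (simp add: ennreal_SUP_add_left[symmetric] SUP_le_iff)
qed

text \<open>
  Disjoint families below disjoint sets can only share the empty set, so their union is a disjoint
  family whose sum is the sum of the two.
\<close>

lemma variation_superadditive:
  assumes "\<mu> {} = 0" "A \<inter> B = {}"
  shows "variation \<mu> A + variation \<mu> B \<le> variation \<mu> (A \<union> B)"
  unfolding variation_def[of \<mu> A] variation_def[of \<mu> B]
proof (rule SUP_add_SUP_le)
  fix P Q
  assume P: "P \<in> {P. finite P \<and> P \<subseteq> borel_algebra \<and> disjoint P \<and> \<Union>P \<subseteq> A}"
    and Q: "Q \<in> {P. finite P \<and> P \<subseteq> borel_algebra \<and> disjoint P \<and> \<Union>P \<subseteq> B}"
  have PQ: "D \<inter> D' = {}" if "D \<in> P" "D' \<in> Q" for D D'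
    using that P Q assms(2) by blast
  then have "\<mu> D = 0" if "D \<in> P \<inter> Q" for D
    using assms(1) that by (metis IntD1 IntD2 Int_absorb)
  then have "(\<Sum>E\<in>P. ennreal \<bar>\<mu> E\<bar>) + (\<Sum>E\<in>Q. ennreal \<bar>\<mu> E\<bar>) = (\<Sum>E\<in>P \<union> Q. ennreal \<bar>\<mu> E\<bar>)"
    using P Q by (subst sum.union_inter_neutral) auto
  also have "\<dots> \<le> variation \<mu> (A \<union> B)"
    unfolding variation_def
  proof (rule SUP_upper)
    have "\<Union>P \<inter> \<Union>Q = {}" using PQ by blast
    then have "disjoint (P \<union> Q)"
      using P Q by (intro disjoint_union) auto
    then show "P \<union> Q \<in> {P. finite P \<and> P \<subseteq> borel_algebra \<and> disjoint P \<and> \<Union>P \<subseteq> A \<union> B}"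
      using P Q by auto
  qed
  finally show "(\<Sum>E\<in>P. ennreal \<bar>\<mu> E\<bar>) + (\<Sum>E\<in>Q. ennreal \<bar>\<mu> E\<bar>) \<le> variation \<mu> (A \<union> B)" .
qed (auto intro!: exI[of _ "{}"])

text \<open>
  The real-valued form in which the variation enters the mean-Cauchy condition of the integral.
\<close>

definition total_variation :: "('a::topological_space set \<Rightarrow> real) \<Rightarrow> 'a set \<Rightarrow> real"
  where "total_variation \<mu> A = enn2real (variation \<mu> A)"

lemma total_variation_nonneg: "0 \<le> total_variation \<mu> A"
  by (simp add: total_variation_def)

lemma ennreal_total_variation:
  assumes "variation \<mu> UNIV < \<infinity>"
  shows "ennreal (total_variation \<mu> A) = variation \<mu> A"
  unfolding total_variation_def
  using le_less_trans[OF variation_mono[of A UNIV \<mu>] assms]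
  by (simp add: ennreal_enn2real_if less_top[symmetric])

lemma additive_total_variation:
  fixes \<mu> :: "'a::topological_space set \<Rightarrow> real"
  assumes add: "Measure_Space.additive borel_algebra \<mu>" and fin: "variation \<mu> UNIV < \<infinity>"
  shows "Measure_Space.additive borel_algebra (total_variation \<mu>)"
  unfolding Measure_Space.additive_def
proof (intro ballI impI)
  fix A B :: "'a set" assume AB: "A \<in> borel_algebra" "B \<in> borel_algebra" "A \<inter> B = {}"
  then have "(A \<union> B) \<inter> A = A" "(A \<union> B) - A = B" by auto
  then have "variation \<mu> (A \<union> B) = variation \<mu> A + variation \<mu> B"
    using variation_subadditive[OF add AB(1), of "A \<union> B"]
      variation_superadditive[where \<mu>=\<mu>, OF additive_empty[OF add] AB(3)] by simp
  then have "ennreal (total_variation \<mu> (A \<union> B)) = ennreal (total_variation \<mu> A + total_variation \<mu> B)"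
    by (simp add: ennreal_total_variation[OF fin] ennreal_plus total_variation_nonneg)
  then show "total_variation \<mu> (A \<union> B) = total_variation \<mu> A + total_variation \<mu> B"
    by (simp add: total_variation_nonneg del: ennreal_plus)
qed

lemma abs_le_total_variation:
  assumes "variation \<mu> UNIV < \<infinity>" "A \<in> borel_algebra"
  shows "\<bar>\<mu> A\<bar> \<le> total_variation \<mu> A"
  using abs_le_variation[OF assms(2), of \<mu>] unfolding ennreal_total_variation[OF assms(1), symmetric]
  by (simp add: total_variation_nonneg)

lemma total_variation_mono:
  assumes "variation \<mu> UNIV < \<infinity>" "A \<subseteq> B"
  shows "total_variation \<mu> A \<le> total_variation \<mu> B"
  using variation_mono[OF assms(2), of \<mu>] unfolding ennreal_total_variation[OF assms(1), symmetric]
  by (simp add: total_variation_nonneg)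

section \<open>Integrals of simple functions\<close>

text \<open>
  Sums and differences of simple functions are handled through finitely valued maps \<open>h\<close> into an
  arbitrary type: with \<open>h\<close> the pair \<open>(s, t)\<close>, the integral of any \<open>\<phi> (s x) (t x)\<close> is a sum over the
  fibers of \<open>h\<close>, which form a common refinement of the partitions of \<open>s\<close> and \<open>t\<close>. Additivity and
  monotonicity can then be read off term by term.
\<close>

lemma fibers_comp:
  fixes h :: "'a::topological_space \<Rightarrow> 'b"
  assumes "finite (range h)" "\<And>z. h -` {z} \<in> borel_algebra"
  shows "(\<lambda>x. \<phi> (h x)) -` {y} = (\<Union>z\<in>{z\<in>range h. \<phi> z = y}. h -` {z})"
    and "(\<lambda>x. \<phi> (h x)) -` {y} \<in> borel_algebra"
proof -
  show eq: "(\<lambda>x. \<phi> (h x)) -` {y} = (\<Union>z\<in>{z\<in>range h. \<phi> z = y}. h -` {z})" by auto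
  show "(\<lambda>x. \<phi> (h x)) -` {y} \<in> borel_algebra"
    unfolding eq using assms by (intro borel_algebra.finite_UN) auto
qed

lemma simple_fun_comp:
  fixes h :: "'a::topological_space \<Rightarrow> 'b"
  assumes "finite (range h)" "\<And>z. h -` {z} \<in> borel_algebra"
  shows "simple_fun (\<lambda>x. \<phi> (h x))"
proof -
  have "range (\<lambda>x. \<phi> (h x)) = \<phi> ` range h" by auto
  then show ?thesis using fibers_comp(2)[OF assms, of \<phi>] assms(1) unfolding simple_fun_def by simp
qed

lemma simple_int_comp:
  fixes h :: "'a::topological_space \<Rightarrow> 'b"
  assumes add: "Measure_Space.additive borel_algebra \<mu>"
    and h: "finite (range h)" "\<And>z. h -` {z} \<in> borel_algebra"
  shows "simple_int \<mu> (\<lambda>x. \<phi> (h x)) = (\<Sum>z\<in>range h. \<phi> z * \<mu> (h -` {z}))"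
proof -
  have eq: "range (\<lambda>x. \<phi> (h x)) = \<phi> ` range h" by auto
  have "\<mu> ((\<lambda>x. \<phi> (h x)) -` {y}) = (\<Sum>z\<in>{z\<in>range h. \<phi> z = y}. \<mu> (h -` {z}))" for y
    unfolding fibers_comp(1)[OF h]
    using h by (intro additive_Union_image[OF add]) (auto simp: disjoint_family_on_def)
  then have "simple_int \<mu> (\<lambda>x. \<phi> (h x)) =
      (\<Sum>y\<in>\<phi> ` range h. \<Sum>z\<in>{z\<in>range h. \<phi> z = y}. \<phi> z * \<mu> (h -` {z}))"
    unfolding simple_int_def eq by (intro sum.cong refl) (simp add: sum_distrib_left)
  also have "\<dots> = (\<Sum>z\<in>range h. \<phi> z * \<mu> (h -` {z}))"
    using h(1) by (intro sum.group) auto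
  finally show ?thesis .
qed

lemma simple_fun_pair:
  assumes "simple_fun s" "simple_fun t"
  shows "finite (range (\<lambda>x. (s x, t x)))" "(\<lambda>x. (s x, t x)) -` {z} \<in> borel_algebra"
proof -
  have "range (\<lambda>x. (s x, t x)) \<subseteq> range s \<times> range t" by auto
  then show "finite (range (\<lambda>x. (s x, t x)))"
    by (rule finite_subset) (use assms in \<open>simp add: simple_fun_def\<close>)
  have "(\<lambda>x. (s x, t x)) -` {z} = s -` {fst z} \<inter> t -` {snd z}" by (cases z) auto
  then show "(\<lambda>x. (s x, t x)) -` {z} \<in> borel_algebra"
    using assms by (auto simp: simple_fun_def)
qed

lemma simple_fun_binop:
  assumes "simple_fun s" "simple_fun t"
  shows "simple_fun (\<lambda>x. \<phi> (s x) (t x))"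
  using simple_fun_comp[OF simple_fun_pair[OF assms], of "\<lambda>(a, b). \<phi> a b"] by simp

lemma simple_fun_unop: "simple_fun s \<Longrightarrow> simple_fun (\<lambda>x. \<phi> (s x))"
  using simple_fun_binop[of s s "\<lambda>a b. \<phi> a"] by simp

lemma simple_fun_const: "simple_fun (\<lambda>x. c)"
  using simple_fun_comp[of "\<lambda>x. ()" "\<lambda>x. c"]
  by (auto simp: vimage_def)

lemma simple_fun_indicator: "A \<in> borel_algebra \<Longrightarrow> simple_fun (indicator A)"
proof -
  assume A: "A \<in> borel_algebra"
  have "(\<lambda>x. x \<in> A) -` {b} \<in> borel_algebra" for b
  proof (cases b)
    case False
    then have "(\<lambda>x. x \<in> A) -` {b} = UNIV - A" by auto
    then show ?thesis using A by (simp add: borel_algebra.compl_sets)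
  qed (use A in \<open>auto simp: vimage_def\<close>)
  then have "simple_fun (\<lambda>x. if x \<in> A then 1 else 0 :: real)"
    using simple_fun_comp[of "\<lambda>x. x \<in> A" "\<lambda>b. if b then 1 else 0"] by simp
  moreover have "(\<lambda>x. if x \<in> A then 1 else 0 :: real) = indicator A"
    by (auto simp: indicator_def)
  ultimately show ?thesis by simp
qed

lemma simple_int_add:
  assumes add: "Measure_Space.additive borel_algebra \<mu>" and "simple_fun s" "simple_fun t"
  shows "simple_int \<mu> (\<lambda>x. s x + t x) = simple_int \<mu> s + simple_int \<mu> t"
  using simple_int_comp[OF add simple_fun_pair[OF assms(2,3)], of "\<lambda>(a, b). a + b"]
    simple_int_comp[OF add simple_fun_pair[OF assms(2,3)], of "\<lambda>(a, b). a"]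
    simple_int_comp[OF add simple_fun_pair[OF assms(2,3)], of "\<lambda>(a, b). b"]
  by (simp add: sum.distrib[symmetric] case_prod_beta distrib_right)

lemma simple_int_cmult:
  assumes add: "Measure_Space.additive borel_algebra \<mu>" and "simple_fun s"
  shows "simple_int \<mu> (\<lambda>x. c * s x) = c * simple_int \<mu> s"
  using simple_int_comp[OF add, of s "\<lambda>a. c * a"] assms(2)
  by (simp add: simple_fun_def simple_int_def sum_distrib_left mult.assoc)

lemma simple_int_diff:
  assumes add: "Measure_Space.additive borel_algebra \<mu>" and "simple_fun s" "simple_fun t"
  shows "simple_int \<mu> (\<lambda>x. s x - t x) = simple_int \<mu> s - simple_int \<mu> t"
  using simple_int_add[OF add assms(2) simple_fun_unop[OF assms(3), of "\<lambda>a. -1 * a"]]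
    simple_int_cmult[OF add assms(3), of "-1"] by simp

lemma simple_int_indicator:
  assumes add: "Measure_Space.additive borel_algebra \<mu>" and A: "A \<in> borel_algebra"
  shows "simple_int \<mu> (indicator A) = \<mu> A"
proof -
  have fib: "indicator A -` {1} = A" by (auto simp: indicator_def split: if_splits)
  have "simple_int \<mu> (indicator A) = (\<Sum>y\<in>{0, 1}. y * \<mu> (indicator A -` {y}))"
    unfolding simple_int_def
  proof (intro sum.mono_neutral_left ballI)
    show "range (indicator A :: 'a \<Rightarrow> real) \<subseteq> {0, 1}" by (auto simp: indicator_def)
    fix y :: real assume "y \<in> {0, 1} - range (indicator A)"
    then have "(indicator A :: 'a \<Rightarrow> real) -` {y} = {}" by auto
    then show "y * \<mu> (indicator A -` {y}) = 0" using additive_empty[OF add] by simp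
  qed auto
  then show ?thesis by (simp add: fib)
qed

lemma simple_int_const:
  assumes "Measure_Space.additive borel_algebra \<mu>"
  shows "simple_int \<mu> (\<lambda>x. c) = c * \<mu> UNIV"
  using simple_int_cmult[OF assms simple_fun_indicator, of UNIV c] simple_int_indicator[OF assms, of UNIV]
  by simp

lemma simple_int_mono:
  assumes add: "Measure_Space.additive borel_algebra \<nu>"
    and nonneg: "\<And>A. A \<in> borel_algebra \<Longrightarrow> 0 \<le> \<nu> A"
    and "simple_fun s" "simple_fun t" "\<And>x. s x \<le> t x"
  shows "simple_int \<nu> s \<le> simple_int \<nu> t"
  using simple_int_comp[OF add simple_fun_pair[OF assms(3,4)], of "\<lambda>(a, b). a"]
    simple_int_comp[OF add simple_fun_pair[OF assms(3,4)], of "\<lambda>(a, b). b"]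
  using simple_fun_pair(2)[OF assms(3,4)] assms(5)
  by (auto intro!: sum_mono mult_right_mono nonneg)

lemma abs_simple_int_le:
  assumes add: "Measure_Space.additive borel_algebra \<mu>" and fin: "variation \<mu> UNIV < \<infinity>"
    and s: "simple_fun s"
  shows "\<bar>simple_int \<mu> s\<bar> \<le> simple_int (total_variation \<mu>) (\<lambda>x. \<bar>s x\<bar>)"
proof -
  have "\<bar>simple_int \<mu> s\<bar> \<le> (\<Sum>y\<in>range s. \<bar>y\<bar> * \<bar>\<mu> (s -` {y})\<bar>)"
    unfolding simple_int_def by (rule order_trans[OF sum_abs]) (simp add: abs_mult)
  also have "\<dots> \<le> (\<Sum>y\<in>range s. \<bar>y\<bar> * total_variation \<mu> (s -` {y}))"
    using s by (intro sum_mono mult_left_mono abs_le_total_variation fin) (auto simp: simple_fun_def)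
  also have "\<dots> = simple_int (total_variation \<mu>) (\<lambda>x. \<bar>s x\<bar>)"
    using s by (intro simple_int_comp[symmetric] additive_total_variation add fin) (auto simp: simple_fun_def)
  finally show ?thesis .
qed

section \<open>Uniqueness of the integral\<close>

lemma outer_variation_le: "A \<in> borel_algebra \<Longrightarrow> E \<subseteq> A \<Longrightarrow> outer_variation \<mu> E \<le> variation \<mu> A"
  unfolding outer_variation_def by (rule INF_lower) simp

lemma small_outer_variation_cover:
  assumes "variation \<mu> UNIV < \<infinity>" "outer_variation \<mu> E < ennreal e"
  obtains A where "A \<in> borel_algebra" "E \<subseteq> A" "total_variation \<mu> A < e"
proof -
  obtain A where "A \<in> borel_algebra" "E \<subseteq> A" "variation \<mu> A < ennreal e"
    using assms(2) unfolding outer_variation_def INF_less_iff by auto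
  then show ?thesis
    using that[of A] by (simp add: ennreal_total_variation[OF assms(1), symmetric] total_variation_nonneg ennreal_less_iff)
qed

lemma total_variation_Un:
  assumes add: "Measure_Space.additive borel_algebra \<mu>" and fin: "variation \<mu> UNIV < \<infinity>"
    and A: "A \<in> borel_algebra" and B: "B \<in> borel_algebra"
  shows "total_variation \<mu> (A \<union> B) \<le> total_variation \<mu> A + total_variation \<mu> B"
  using additiveD[OF additive_total_variation[OF add fin], of A "B - A"] A B
    total_variation_mono[OF fin, of "B - A" B] by (auto simp: borel_algebra.Diff)

text \<open>
  Let \<open>s n\<close> and \<open>t n\<close> both define an integral of \<open>f\<close>. Their difference \<open>g n = \<bar>s n - t n\<bar>\<close> is Cauchy in
  mean and tends to \<open>0\<close> in measure. Compare with a fixed late index \<open>N\<close>: where \<open>g n\<close> is small its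
  integral is small, and on the remaining set, whose variation is small, \<open>g n\<close> is up to a mean-small error
  at most the bound of \<open>g N\<close>.
\<close>

theorem has_ds_integral_unique:
  assumes add: "Measure_Space.additive borel_algebra \<mu>" and fin: "variation \<mu> UNIV < \<infinity>"
    and I: "has_ds_integral \<mu> f I" and J: "has_ds_integral \<mu> f J"
  shows "I = J"
proof -
  let ?v = "total_variation \<mu>"
  have v_eq: "(\<lambda>A. enn2real (variation \<mu> A)) = ?v"
    by (rule ext) (simp add: total_variation_def)
  note v_add = additive_total_variation[OF add fin]
  obtain s where s: "\<And>n. simple_fun (s n)"
      "\<And>e. e > 0 \<Longrightarrow> (\<lambda>n. outer_variation \<mu> {x. \<bar>s n x - f x\<bar> > e}) \<longlonglongrightarrow> 0"
      "\<And>e. e > 0 \<Longrightarrow> \<exists>N. \<forall>m\<ge>N. \<forall>n\<ge>N. simple_int ?v (\<lambda>x. \<bar>s m x - s n x\<bar>) < e"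
      "(\<lambda>n. simple_int \<mu> (s n)) \<longlonglongrightarrow> I"
    using I unfolding has_ds_integral_def v_eq by auto
  obtain t where t: "\<And>n. simple_fun (t n)"
      "\<And>e. e > 0 \<Longrightarrow> (\<lambda>n. outer_variation \<mu> {x. \<bar>t n x - f x\<bar> > e}) \<longlonglongrightarrow> 0"
      "\<And>e. e > 0 \<Longrightarrow> \<exists>N. \<forall>m\<ge>N. \<forall>n\<ge>N. simple_int ?v (\<lambda>x. \<bar>t m x - t n x\<bar>) < e"
      "(\<lambda>n. simple_int \<mu> (t n)) \<longlonglongrightarrow> J"
    using J unfolding has_ds_integral_def v_eq by auto
  have bound: "\<bar>I - J\<bar> \<le> e * (3 + ?v UNIV)" if e: "e > 0" for e
  proof -
    obtain N1 where N1: "\<forall>m\<ge>N1. \<forall>n\<ge>N1. simple_int ?v (\<lambda>x. \<bar>s m x - s n x\<bar>) < e"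
      using s(3)[OF e] by blast
    obtain N2 where N2: "\<forall>m\<ge>N2. \<forall>n\<ge>N2. simple_int ?v (\<lambda>x. \<bar>t m x - t n x\<bar>) < e"
      using t(3)[OF e] by blast
    define N where "N = max N1 N2"
    have "finite (range (\<lambda>x. \<bar>s N x - t N x\<bar>))"
      using simple_fun_binop[OF s(1)[of N] t(1)[of N], of "\<lambda>a b. \<bar>a - b\<bar>"] by (simp add: simple_fun_def)
    then obtain K where K: "\<And>x. \<bar>s N x - t N x\<bar> \<le> K"
      using bdd_above_finite[of "range (\<lambda>x. \<bar>s N x - t N x\<bar>)"] by (auto simp: bdd_above_def)
    have K0: "0 \<le> K" using order_trans[OF abs_ge_zero K[of undefined]] .
    \<comment> \<open>chosen so that two sets of total variation below \<open>d\<close> contribute at most \<open>e\<close> to the integral of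
      \<open>\<bar>s N - t N\<bar>\<close>; the \<open>1\<close> avoids division by zero\<close>
    define d where "d = e / (2 * (K + 1))"
    have d: "d > 0" using e K0 by (simp add: d_def)
    have "\<forall>\<^sub>F n in sequentially. outer_variation \<mu> {x. \<bar>s n x - f x\<bar> > e / 2} < ennreal d"
      "\<forall>\<^sub>F n in sequentially. outer_variation \<mu> {x. \<bar>t n x - f x\<bar> > e / 2} < ennreal d"
      using s(2)[of "e / 2"] t(2)[of "e / 2"] e d by (auto intro: order_tendstoD(2))
    then have "\<forall>\<^sub>F n in sequentially. \<bar>simple_int \<mu> (s n) - simple_int \<mu> (t n)\<bar> \<le> e * (3 + ?v UNIV)"
      using eventually_ge_at_top[of N]
    proof eventually_elim
      case (elim n)
      obtain A where A: "A \<in> borel_algebra" "{x. \<bar>s n x - f x\<bar> > e / 2} \<subseteq> A" "?v A < d"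
        using small_outer_variation_cover[OF fin elim(1)] .
      obtain B where B: "B \<in> borel_algebra" "{x. \<bar>t n x - f x\<bar> > e / 2} \<subseteq> B" "?v B < d"
        using small_outer_variation_cover[OF fin elim(2)] .
      let ?g = "\<lambda>x. \<bar>s n x - t n x\<bar>"
      let ?a = "\<lambda>x. \<bar>s n x - s N x\<bar>" and ?b = "\<lambda>x. \<bar>t n x - t N x\<bar>"
      let ?c = "\<lambda>x. K * indicator (A \<union> B) x"
      have simple: "simple_fun ?g" "simple_fun ?a" "simple_fun ?b" "simple_fun ?c"
        using A(1) B(1) simple_fun_binop[where \<phi>="\<lambda>a b. \<bar>a - b\<bar>", OF s(1) t(1)]
          simple_fun_binop[where \<phi>="\<lambda>a b. \<bar>a - b\<bar>", OF s(1) s(1)]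
          simple_fun_binop[where \<phi>="\<lambda>a b. \<bar>a - b\<bar>", OF t(1) t(1)]
          simple_fun_unop[where \<phi>="\<lambda>a. K * a", OF simple_fun_indicator[of "A \<union> B"]]
        by (simp_all add: borel_algebra.Un)
      have sum: "simple_fun (\<lambda>x. ?a x + ?b x)" "simple_fun (\<lambda>x. ?a x + ?b x + ?c x)"
        "simple_fun (\<lambda>x. ?a x + ?b x + ?c x + e)"
        by (intro simple_fun_binop[where \<phi>="(+)"] simple simple_fun_const)+
      have pointwise: "?g x \<le> ?a x + ?b x + ?c x + e" for x
      proof (cases "x \<in> A \<union> B")
        case True
        then show ?thesis using K[of x] e by simp
      next
        case False
        then have "\<not> \<bar>s n x - f x\<bar> > e / 2" "\<not> \<bar>t n x - f x\<bar> > e / 2" using A(2) B(2) by auto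
        then have "?g x \<le> e" by linarith
        then show ?thesis using False by simp
      qed
      have "\<bar>simple_int \<mu> (s n) - simple_int \<mu> (t n)\<bar> \<le> simple_int ?v ?g"
        using abs_simple_int_le[OF add fin simple_fun_binop[OF s(1)[of n] t(1)[of n], of "(-)"]]
        by (simp add: simple_int_diff[OF add s(1) t(1)])
      also have "\<dots> \<le> simple_int ?v (\<lambda>x. ?a x + ?b x + ?c x + e)"
        by (intro simple_int_mono[OF v_add] total_variation_nonneg simple(1) sum(3) pointwise)
      also have "\<dots> = simple_int ?v ?a + simple_int ?v ?b + K * ?v (A \<union> B) + e * ?v UNIV"
        using A(1) B(1) by (simp add: simple_int_add[OF v_add] simple sum simple_fun_const simple_int_const[OF v_add]
            simple_int_cmult[OF v_add] simple_fun_indicator simple_int_indicator[OF v_add] borel_algebra.Un)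
      also have "\<dots> \<le> e + e + e + e * ?v UNIV"
      proof -
        have "K * ?v (A \<union> B) \<le> K * (2 * d)"
          using total_variation_Un[OF add fin A(1) B(1)] A(3) B(3) K0 by (intro mult_left_mono) auto
        also have "\<dots> \<le> e" using e K0 by (simp add: d_def field_simps)
        finally show ?thesis
          using N1[rule_format, of n N] N2[rule_format, of n N] elim(3) by (auto simp: N_def)
      qed
      finally show ?case by (simp add: algebra_simps)
    qed
    moreover have "(\<lambda>n. \<bar>simple_int \<mu> (s n) - simple_int \<mu> (t n)\<bar>) \<longlonglongrightarrow> \<bar>I - J\<bar>"
      using s(4) t(4) by (intro tendsto_intros)
    ultimately show ?thesis
      by (intro tendsto_upperbound[where F=sequentially]) auto
  qed
  have c: "0 < 3 + ?v UNIV" using total_variation_nonneg[of \<mu> UNIV] by simp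
  have "\<bar>I - J\<bar> \<le> e" if "e > 0" for e
    using bound[of "e / (3 + ?v UNIV)"] that c by simp
  then show "I = J" by (metis abs_le_zero_iff dense_ge eq_iff_diff_eq_0)
qed

section \<open>Positive functionals and closed regular contents\<close>

lemma Urysohn_metric:
  fixes S T :: "'a::metric_space set"
  assumes "closed S" "closed T" "S \<inter> T = {}"
  shows "\<exists>h :: 'a \<Rightarrow> real. continuous_on UNIV h \<and> (\<forall>x. 0 \<le> h x \<and> h x \<le> 1) \<and>
    (\<forall>x\<in>S. h x = 0) \<and> (\<forall>x\<in>T. h x = 1)"
proof -
  have "normal_space (euclidean :: 'a topology)"
    by (intro metrizable_imp_normal_space metrizable_space_euclidean)
  then obtain h where h: "continuous_map euclidean (top_of_set {0..1::real}) h" "h ` S \<subseteq> {0}" "h ` T \<subseteq> {1}"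
    using Urysohn_lemma[of euclidean S T 0 1] assms by (auto simp: disjnt_def)
  then have "continuous_on UNIV h" "h \<in> UNIV \<rightarrow> {0..1}"
    by (auto simp: continuous_map_in_subtopology)
  then show ?thesis using h by (intro exI[of _ h]) (auto simp: Pi_iff image_subset_iff)
qed

definition nonneg_bounded_cont :: "('a::topological_space \<Rightarrow> real) set"
  where "nonneg_bounded_cont = {f. continuous_on UNIV f \<and> (\<forall>x. 0 \<le> f x) \<and> (\<exists>c. \<forall>x. f x \<le> c)}"

lemma nonneg_bounded_contI:
  "continuous_on UNIV f \<Longrightarrow> (\<And>x. 0 \<le> f x) \<Longrightarrow> (\<And>x. f x \<le> c) \<Longrightarrow> f \<in> nonneg_bounded_cont"
  by (auto simp: nonneg_bounded_cont_def)

lemma nonneg_bounded_cont_const: "0 \<le> c \<Longrightarrow> (\<lambda>x. c) \<in> nonneg_bounded_cont"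
  by (auto simp: nonneg_bounded_cont_def)

lemma nonneg_bounded_cont_add:
  assumes "f \<in> nonneg_bounded_cont" "g \<in> nonneg_bounded_cont"
  shows "(\<lambda>x. f x + g x) \<in> nonneg_bounded_cont"
proof -
  obtain b c where "\<forall>x. f x \<le> b" "\<forall>x. g x \<le> c" using assms by (auto simp: nonneg_bounded_cont_def)
  then show ?thesis using assms
    by (intro nonneg_bounded_contI[where c="b + c"])
      (auto simp: nonneg_bounded_cont_def intro: continuous_intros add_mono)
qed

lemma nonneg_bounded_cont_scale:
  assumes "f \<in> nonneg_bounded_cont" "0 \<le> c"
  shows "(\<lambda>x. c * f x) \<in> nonneg_bounded_cont"
proof -
  obtain b where "\<forall>x. f x \<le> b" using assms by (auto simp: nonneg_bounded_cont_def)
  then show ?thesis using assms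
    by (intro nonneg_bounded_contI[where c="c * b"])
      (auto simp: nonneg_bounded_cont_def intro: continuous_intros mult_left_mono)
qed

lemma nonneg_bounded_cont_dominated:
  assumes "f \<in> nonneg_bounded_cont" "continuous_on UNIV g" "\<And>x. 0 \<le> g x" "\<And>x. g x \<le> f x"
  shows "g \<in> nonneg_bounded_cont"
proof -
  obtain b where "\<forall>x. f x \<le> b" using assms by (auto simp: nonneg_bounded_cont_def)
  then show ?thesis using assms by (intro nonneg_bounded_contI[where c=b]) (auto intro: order_trans)
qed

text \<open>
  The last two conditions say that the indicator of a closed set, though not continuous, behaves as
  if \<open>L\<close> could be applied to it: \<open>\<nu> K\<close> lies between the values of \<open>L\<close> on the functions below and above
  the indicator. They determine the integral of every bounded continuous function.
\<close>

definition riesz_content :: "(('a::topological_space \<Rightarrow> real) \<Rightarrow> real) \<Rightarrow> ('a set \<Rightarrow> real) \<Rightarrow> bool"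
  where "riesz_content L \<nu> \<longleftrightarrow>
    Measure_Space.additive borel_algebra \<nu> \<and> (\<forall>A. 0 \<le> \<nu> A) \<and>
    (\<forall>A\<in>borel_algebra. \<forall>\<epsilon>>0. \<exists>C U. closed C \<and> open U \<and> C \<subseteq> A \<and> A \<subseteq> U \<and> \<nu> (U - C) < \<epsilon>) \<and>
    (\<forall>K. \<forall>f\<in>nonneg_bounded_cont. closed K \<longrightarrow> (\<forall>x\<in>K. 1 \<le> f x) \<longrightarrow> \<nu> K \<le> L f) \<and>
    (\<forall>K. \<forall>f\<in>nonneg_bounded_cont. closed K \<longrightarrow> (\<forall>x. f x \<le> 1) \<longrightarrow> (\<forall>x. x \<notin> K \<longrightarrow> f x = 0) \<longrightarrow> L f \<le> \<nu> K)"

lemma riesz_contentD: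
  assumes "riesz_content L \<nu>"
  shows "Measure_Space.additive borel_algebra \<nu>" and "0 \<le> \<nu> A"
    and "A \<in> borel_algebra \<Longrightarrow> 0 < e \<Longrightarrow> \<exists>C U. closed C \<and> open U \<and> C \<subseteq> A \<and> A \<subseteq> U \<and> \<nu> (U - C) < e"
    and "f \<in> nonneg_bounded_cont \<Longrightarrow> closed K \<Longrightarrow> (\<And>x. x \<in> K \<Longrightarrow> 1 \<le> f x) \<Longrightarrow> \<nu> K \<le> L f"
    and "f \<in> nonneg_bounded_cont \<Longrightarrow> closed K \<Longrightarrow> (\<And>x. f x \<le> 1) \<Longrightarrow> (\<And>x. x \<notin> K \<Longrightarrow> f x = 0) \<Longrightarrow> L f \<le> \<nu> K"
  using assms by (simp_all add: riesz_content_def)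

locale positive_functional =
  fixes L :: "('a::metric_space \<Rightarrow> real) \<Rightarrow> real"
  assumes nonneg: "f \<in> nonneg_bounded_cont \<Longrightarrow> 0 \<le> L f"
    and add: "f \<in> nonneg_bounded_cont \<Longrightarrow> g \<in> nonneg_bounded_cont \<Longrightarrow> L (\<lambda>x. f x + g x) = L f + L g"
    and scale: "f \<in> nonneg_bounded_cont \<Longrightarrow> 0 \<le> c \<Longrightarrow> L (\<lambda>x. c * f x) = c * L f"
begin

lemma zero: "L (\<lambda>x. 0) = 0"
  using scale[of "\<lambda>x. 0" 0] nonneg_bounded_cont_const[of 0] by simp

lemma mono:
  assumes f: "f \<in> nonneg_bounded_cont" and g: "g \<in> nonneg_bounded_cont" and le: "\<And>x. f x \<le> g x"
  shows "L f \<le> L g"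
proof -
  have "(\<lambda>x. g x - f x) \<in> nonneg_bounded_cont"
    using f le
    by (intro nonneg_bounded_cont_dominated[OF g])
      (use g in \<open>auto simp: nonneg_bounded_cont_def intro: continuous_intros\<close>)
  then show ?thesis using add[OF f, of "\<lambda>x. g x - f x"] nonneg[of "\<lambda>x. g x - f x"] by simp
qed

definition closed_content :: "'a set \<Rightarrow> ennreal"
  where "closed_content K = (INF f\<in>{f\<in>nonneg_bounded_cont. \<forall>x\<in>K. 1 \<le> f x}. ennreal (L f))"

definition inner_content :: "'a set \<Rightarrow> ennreal"
  where "inner_content E = (SUP K\<in>{K. closed K \<and> K \<subseteq> E}. closed_content K)"

lemma closed_content_le:
  "f \<in> nonneg_bounded_cont \<Longrightarrow> (\<And>x. x \<in> K \<Longrightarrow> 1 \<le> f x) \<Longrightarrow> closed_content K \<le> ennreal (L f)"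
  unfolding closed_content_def by (rule INF_lower) simp

lemma closed_content_mono: "K \<subseteq> K' \<Longrightarrow> closed_content K \<le> closed_content K'"
  unfolding closed_content_def by (rule INF_superset_mono) auto

lemma closed_content_empty: "closed_content {} = 0"
  using closed_content_le[OF nonneg_bounded_cont_const[of 0], of "{}"] zero by simp

lemma closed_content_finite: "closed_content K \<le> ennreal (L (\<lambda>x. 1))"
  using closed_content_le[OF nonneg_bounded_cont_const[of 1], of K] by simp

lemma closed_content_approx:
  assumes "0 < e"
  obtains f where "f \<in> nonneg_bounded_cont" "\<And>x. x \<in> K \<Longrightarrow> 1 \<le> f x" "ennreal (L f) \<le> closed_content K + ennreal e"
proof -
  have "closed_content K < closed_content K + ennreal e"
    using closed_content_finite[of K] assms by (simp add: less_top[symmetric] top_unique ennreal_add_left_cancel_less) (auto simp: top_unique)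
  then obtain f where "f \<in> nonneg_bounded_cont" "\<forall>x\<in>K. 1 \<le> f x" "ennreal (L f) < closed_content K + ennreal e"
    unfolding closed_content_def[of K] INF_less_iff by auto
  then show ?thesis using that[of f] by auto
qed

lemma inner_content_mono: "A \<subseteq> B \<Longrightarrow> inner_content A \<le> inner_content B"
  unfolding inner_content_def by (rule SUP_subset_mono) auto

lemma inner_content_closed: "closed K \<Longrightarrow> inner_content K = closed_content K"
  unfolding inner_content_def
  by (intro antisym SUP_least closed_content_mono) (auto intro: SUP_upper)

lemma inner_content_finite: "inner_content E \<le> ennreal (L (\<lambda>x. 1))"
  unfolding inner_content_def by (intro SUP_least closed_content_finite)

text \<open>
  An Urysohn function that separates the two sets splits every \<open>f \<ge> 1\<close> on the union into a summand that is
  \<open>\<ge> 1\<close> on the one set and a summand that is \<open>\<ge> 1\<close> on the other.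
\<close>

lemma closed_content_disjoint:
  assumes K: "closed K1" "closed K2" "K1 \<inter> K2 = {}"
  shows "closed_content K1 + closed_content K2 \<le> closed_content (K1 \<union> K2)"
  unfolding closed_content_def[of "K1 \<union> K2"]
proof (rule INF_greatest)
  fix f assume "f \<in> {f\<in>nonneg_bounded_cont. \<forall>x\<in>K1 \<union> K2. 1 \<le> f x}"
  then have f: "f \<in> nonneg_bounded_cont" "\<And>x. x \<in> K1 \<union> K2 \<Longrightarrow> 1 \<le> f x" by auto
  then have cf: "continuous_on UNIV f" "\<And>x. 0 \<le> f x" by (auto simp: nonneg_bounded_cont_def)
  obtain h :: "'a \<Rightarrow> real" where h: "continuous_on UNIV h" "\<forall>x. 0 \<le> h x \<and> h x \<le> 1" "\<forall>x\<in>K1. h x = 0" "\<forall>x\<in>K2. h x = 1"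
    using Urysohn_metric[OF K] by blast
  let ?f1 = "\<lambda>x. f x * (1 - h x)" and ?f2 = "\<lambda>x. f x * h x"
  have le: "?f1 x \<le> f x" "?f2 x \<le> f x" and ge: "0 \<le> ?f1 x" "0 \<le> ?f2 x" for x
    using mult_left_le[of "1 - h x" "f x"] mult_left_le[of "h x" "f x"] cf(2)[of x] h(2) by auto
  have f1: "?f1 \<in> nonneg_bounded_cont"
    by (rule nonneg_bounded_cont_dominated[OF f(1) _ ge(1) le(1)]) (intro continuous_intros cf h)
  have f2: "?f2 \<in> nonneg_bounded_cont"
    by (rule nonneg_bounded_cont_dominated[OF f(1) _ ge(2) le(2)]) (intro continuous_intros cf h)
  have "closed_content K1 + closed_content K2 \<le> ennreal (L ?f1) + ennreal (L ?f2)"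
    by (intro add_mono closed_content_le f1 f2) (use h f(2) in auto)
  also have "\<dots> = ennreal (L ?f1 + L ?f2)"
    using nonneg[OF f1] nonneg[OF f2] by simp
  also have "L ?f1 + L ?f2 = L f"
    using add[OF f1 f2] by (simp add: algebra_simps)
  finally show "closed_content K1 + closed_content K2 \<le> ennreal (L f)" .
qed

text \<open>
  Take a nearly optimal \<open>f\<close> for \<open>K \<inter> C\<close>. It still exceeds \<open>1 - d\<close> near \<open>K \<inter> C\<close>, so what it misses of
  \<open>K\<close> is a closed set \<open>K2\<close> disjoint from \<open>C\<close>. Adding a nearly optimal \<open>g\<close> for \<open>K2\<close> gives a function
  that is at least \<open>1 - d\<close> on all of \<open>K\<close>.
\<close>

lemma closed_content_tight:
  assumes K: "closed K" and C: "closed C"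
  shows "closed_content K \<le> closed_content (K \<inter> C) + inner_content (K - C)"
proof (rule ennreal_le_epsilon)
  fix e :: real assume e: "0 < e"
  define k where "k = enn2real (closed_content K)"
  have k: "closed_content K = ennreal k" "0 \<le> k"
    using closed_content_finite[of K] by (auto simp: k_def ennreal_enn2real_if top_unique)
  \<comment> \<open>rescaling by \<open>1 / (1 - d)\<close> must cost at most \<open>e / 3\<close>, that is \<open>d * k \<le> e / 3\<close>; the summand
    \<open>e\<close> in the denominator covers \<open>k = 0\<close> and keeps \<open>d < 1\<close>\<close>
  define d where "d = e / (3 * (k + e))"
  have d: "0 < d" "d < 1" "d * k \<le> e / 3"
    using e k(2) by (auto simp: d_def field_simps add_pos_nonneg)
  obtain f where f: "f \<in> nonneg_bounded_cont" "\<And>x. x \<in> K \<inter> C \<Longrightarrow> 1 \<le> f x"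
      "ennreal (L f) \<le> closed_content (K \<inter> C) + ennreal (e / 3)"
    by (rule closed_content_approx[of "e / 3" "K \<inter> C"]) (use e in auto)
  define K2 where "K2 = K \<inter> {x. f x \<le> 1 - d}"
  have cf: "continuous_on UNIV f" using f by (simp add: nonneg_bounded_cont_def)
  have "closed K2"
    unfolding K2_def by (intro closed_Int K closed_Collect_le continuous_intros cf)
  moreover have "K2 \<subseteq> K - C" using f(2) d by (force simp: K2_def)
  ultimately have K2: "closed_content K2 \<le> inner_content (K - C)"
    unfolding inner_content_def by (intro SUP_upper) auto
  obtain g where g: "g \<in> nonneg_bounded_cont" "\<And>x. x \<in> K2 \<Longrightarrow> 1 \<le> g x"
      "ennreal (L g) \<le> closed_content K2 + ennreal (e / 3)"
    by (rule closed_content_approx[of "e / 3" K2]) (use e in auto)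
  have fg: "(\<lambda>x. f x + g x) \<in> nonneg_bounded_cont"
    by (intro nonneg_bounded_cont_add f g)
  have "1 \<le> 1 / (1 - d) * (f x + g x)" if "x \<in> K" for x
  proof -
    have "0 \<le> f x" "0 \<le> g x" using f(1) g(1) by (auto simp: nonneg_bounded_cont_def)
    moreover have "1 \<le> g x \<or> 1 - d < f x" using g(2)[of x] that by (auto simp: K2_def)
    ultimately have "1 - d \<le> f x + g x" using d by auto
    then show ?thesis using d by (simp add: field_simps)
  qed
  then have "closed_content K \<le> ennreal (L (\<lambda>x. 1 / (1 - d) * (f x + g x)))"
    using d by (intro closed_content_le nonneg_bounded_cont_scale fg) auto
  also have "L (\<lambda>x. 1 / (1 - d) * (f x + g x)) = (L f + L g) / (1 - d)"
    using scale[OF fg, of "1 / (1 - d)"] add[OF f(1) g(1)] d by simp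
  finally have "k \<le> (L f + L g) / (1 - d)"
    unfolding k(1) using d nonneg[OF f(1)] nonneg[OF g(1)] by (subst (asm) ennreal_le_iff) auto
  then have "k \<le> L f + L g + e / 3"
    using d by (simp add: field_simps)
  then have "closed_content K \<le> ennreal (L f + L g + e / 3)"
    unfolding k(1) by (rule ennreal_leI)
  also have "\<dots> = ennreal (L f) + ennreal (L g) + ennreal (e / 3)"
    using e nonneg[OF f(1)] nonneg[OF g(1)] by simp
  also have "\<dots> \<le> (closed_content (K \<inter> C) + ennreal (e / 3)) + (inner_content (K - C) + ennreal (e / 3)) + ennreal (e / 3)"
    using f(3) g(3) K2 by (intro add_mono) (auto intro: order_trans add_mono)
  also have "\<dots> = closed_content (K \<inter> C) + inner_content (K - C) + (ennreal (e / 3) + ennreal (e / 3) + ennreal (e / 3))"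
    by (simp add: ac_simps)
  also have "ennreal (e / 3) + ennreal (e / 3) + ennreal (e / 3) = ennreal e"
    using e by (simp flip: ennreal_plus)
  finally show "closed_content K \<le> closed_content (K \<inter> C) + inner_content (K - C) + ennreal e" .
qed

text \<open>
  Membership in the Caratheodory system asks that \<open>C\<close> split every set additively. One inequality is
  \<open>closed_content_disjoint\<close>, the other \<open>closed_content_tight\<close>, each passed to suprema over closed subsets.
\<close>

lemma closed_in_lambda_system:
  assumes C: "closed C"
  shows "C \<in> lambda_system UNIV (Pow UNIV) inner_content"
  unfolding lambda_system_def
proof (intro CollectI conjI ballI)
  fix E :: "'a set"
  show "inner_content (C \<inter> E) + inner_content ((UNIV - C) \<inter> E) = inner_content E"
  proof (rule antisym)
    show "inner_content (C \<inter> E) + inner_content ((UNIV - C) \<inter> E) \<le> inner_content E"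
      unfolding inner_content_def[of "C \<inter> E"] inner_content_def[of "(UNIV - C) \<inter> E"]
    proof (rule SUP_add_SUP_le)
      fix K1 K2 assume "K1 \<in> {K. closed K \<and> K \<subseteq> C \<inter> E}" "K2 \<in> {K. closed K \<and> K \<subseteq> (UNIV - C) \<inter> E}"
      then have K: "closed K1" "closed K2" "K1 \<inter> K2 = {}" "K1 \<union> K2 \<subseteq> E" by auto
      show "closed_content K1 + closed_content K2 \<le> inner_content E"
        using closed_content_disjoint[OF K(1-3)] inner_content_mono[OF K(4)]
          inner_content_closed[OF closed_Un[OF K(1,2)]] by auto
    qed (auto intro: exI[of _ "{}"])
    show "inner_content E \<le> inner_content (C \<inter> E) + inner_content ((UNIV - C) \<inter> E)"
      unfolding inner_content_def[of E]
    proof (rule SUP_least)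
      fix K assume K: "K \<in> {K. closed K \<and> K \<subseteq> E}"
      then have "closed_content (K \<inter> C) = inner_content (K \<inter> C)"
        using C by (intro inner_content_closed[symmetric]) auto
      then have "closed_content K \<le> inner_content (K \<inter> C) + inner_content (K - C)"
        using closed_content_tight[of K C] K C by auto
      also have "\<dots> \<le> inner_content (C \<inter> E) + inner_content ((UNIV - C) \<inter> E)"
        using K by (intro add_mono inner_content_mono) auto
      finally show "closed_content K \<le> inner_content (C \<inter> E) + inner_content ((UNIV - C) \<inter> E)" .
    qed
  qed
qed auto

lemma inner_content_empty: "inner_content {} = 0"
  using inner_content_closed[of "{}"] closed_content_empty by simp

text \<open>
  The Caratheodory system of any set function that vanishes on the empty set is an algebra on which
  the function is additive, so it remains that it contains the closed sets.
\<close>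

lemma additive_inner_content: "Measure_Space.additive borel_algebra inner_content"
proof -
  interpret Pow: algebra UNIV "Pow UNIV :: 'a set set" by (rule algebra_Pow)
  have "algebra UNIV (lambda_system UNIV (Pow UNIV) inner_content)"
    using inner_content_empty by (intro Pow.lambda_system_algebra) (simp add: positive_def)
  then have "borel_algebra \<subseteq> lambda_system UNIV (Pow UNIV) inner_content"
    unfolding borel_algebra_def using closed_in_lambda_system by (intro hull_minimal) auto
  then show ?thesis
    using Pow.lambda_system_additive[of inner_content] by (auto simp: Measure_Space.additive_def)
qed

theorem riesz_content_exists: "\<exists>\<nu>. riesz_content L \<nu>"
proof -
  define \<nu> where "\<nu> E = enn2real (inner_content E)" for E
  have \<nu>: "ennreal (\<nu> E) = inner_content E" and pos: "0 \<le> \<nu> E" for E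
    using inner_content_finite[of E] by (auto simp: \<nu>_def ennreal_enn2real_if top_unique)
  have add: "Measure_Space.additive borel_algebra \<nu>"
    unfolding Measure_Space.additive_def
  proof (intro ballI impI)
    fix A B :: "'a set" assume "A \<in> borel_algebra" "B \<in> borel_algebra" "A \<inter> B = {}"
    then have "inner_content (A \<union> B) = inner_content A + inner_content B"
      by (intro additiveD[OF additive_inner_content])
    then have "ennreal (\<nu> (A \<union> B)) = ennreal (\<nu> A + \<nu> B)" by (simp add: \<nu> pos)
    then show "\<nu> (A \<union> B) = \<nu> A + \<nu> B" using pos by (simp del: ennreal_plus)
  qed
  have inner: "\<exists>K. closed K \<and> K \<subseteq> A \<and> \<nu> A < \<nu> K + e" if e: "0 < e" for A e
  proof (rule ccontr)
    assume none: "\<not> ?thesis"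
    have le: "\<nu> K \<le> \<nu> A - e" if "closed K" "K \<subseteq> A" for K
    proof -
      have "\<not> \<nu> A < \<nu> K + e" using none that by blast
      then show ?thesis by linarith
    qed
    have "inner_content A \<le> ennreal (\<nu> A - e)"
      unfolding inner_content_def[of A]
    proof (rule SUP_least)
      fix K assume K: "K \<in> {K. closed K \<and> K \<subseteq> A}"
      then have "closed_content K = ennreal (\<nu> K)" by (simp add: \<nu> inner_content_closed)
      then show "closed_content K \<le> ennreal (\<nu> A - e)" using K le[of K] by (simp add: ennreal_leI)
    qed
    moreover have "0 \<le> \<nu> A - e" using le[of "{}"] pos[of "{}"] by simp
    ultimately show False using e by (simp add: \<nu>[symmetric])
  qed
  have regular: "\<exists>C U. closed C \<and> open U \<and> C \<subseteq> A \<and> A \<subseteq> U \<and> \<nu> (U - C) < e"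
    if A: "A \<in> borel_algebra" and e: "0 < e" for A e
  proof -
    obtain C where C: "closed C" "C \<subseteq> A" "\<nu> A < \<nu> C + e / 2" using inner[of "e / 2" A] e by auto
    \<comment> \<open>the complement of \<open>D\<close> is the open approximation of \<open>A\<close> from outside\<close>
    obtain D where D: "closed D" "D \<subseteq> UNIV - A" "\<nu> (UNIV - A) < \<nu> D + e / 2"
      using inner[of "e / 2" "UNIV - A"] e by auto
    have sub: "C \<subseteq> - D" using C(2) D(2) by auto
    have "\<nu> (- D - C) = \<nu> (- D) - \<nu> C"
      using C D sub by (intro additive_Diff[OF add] closed_in_borel_algebra open_in_borel_algebra) auto
    also have "\<nu> (- D) = \<nu> UNIV - \<nu> D"
      using additive_Diff[OF add closed_in_borel_algebra[OF D(1)], of UNIV] by (simp add: Compl_eq_Diff_UNIV)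
    also have "\<nu> UNIV = \<nu> A + \<nu> (UNIV - A)"
      using additive_Diff[OF add A, of UNIV] by simp
    finally have "\<nu> (- D - C) < e" using C(3) D(3) by simp
    then show ?thesis using C D by (intro exI[of _ C] exI[of _ "- D"]) auto
  qed
  have upper: "\<nu> K \<le> L f" if "f \<in> nonneg_bounded_cont" "closed K" "\<forall>x\<in>K. 1 \<le> f x" for K f
  proof -
    have "ennreal (\<nu> K) \<le> ennreal (L f)"
      using that by (simp add: \<nu> inner_content_closed closed_content_le)
    then show ?thesis using nonneg[OF that(1)] by simp
  qed
  have lower: "L f \<le> \<nu> K"
    if f: "f \<in> nonneg_bounded_cont" "closed K" "\<forall>x. f x \<le> 1" "\<forall>x. x \<notin> K \<longrightarrow> f x = 0" for K f
  proof -
    have "ennreal (L f) \<le> closed_content K"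
      unfolding closed_content_def
    proof (rule INF_greatest)
      fix h assume h: "h \<in> {f\<in>nonneg_bounded_cont. \<forall>x\<in>K. 1 \<le> f x}"
      have "f x \<le> h x" for x
        using f h by (cases "x \<in> K") (auto simp: nonneg_bounded_cont_def intro: order_trans)
      then show "ennreal (L f) \<le> ennreal (L h)" using f h by (intro ennreal_leI mono) auto
    qed
    also have "closed_content K = ennreal (\<nu> K)" using f(2) by (simp add: \<nu> inner_content_closed)
    finally show ?thesis using pos by simp
  qed
  show ?thesis
    unfolding riesz_content_def
    by (intro exI[of _ \<nu>] conjI allI ballI impI add pos regular upper lower; simp)
qed

end

section \<open>The layer cake approximation\<close>

text \<open>
  A nonnegative \<open>g\<close> rounded down to a multiple of \<open>\<delta>\<close>, cut off at \<open>m * \<delta>\<close>. It is written as a sum of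
  indicators of closed superlevel sets, whose contents are compared with \<open>L\<close>.
\<close>

definition layers :: "('a \<Rightarrow> real) \<Rightarrow> real \<Rightarrow> nat \<Rightarrow> 'a \<Rightarrow> real"
  where "layers g \<delta> m x = (\<Sum>i<m. \<delta> * indicator {y. real (Suc i) * \<delta> \<le> g y} x)"

text \<open>
  The part of the value \<open>t\<close> that lies between the heights \<open>i * \<delta>\<close> and \<open>(i + 1) * \<delta>\<close>; it lies between
  \<open>\<delta>\<close> times the indicators of \<open>(i + 1) * \<delta> \<le> t\<close> and \<open>i * \<delta> \<le> t\<close>.
\<close>

definition ramp :: "real \<Rightarrow> nat \<Rightarrow> real \<Rightarrow> real"
  where "ramp \<delta> i t = min (max (t - real i * \<delta>) 0) \<delta>"

lemma sum_ramp:
  assumes "0 < \<delta>" "0 \<le> t"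
  shows "(\<Sum>i<m. ramp \<delta> i t) = min t (real m * \<delta>)"
proof (induction m)
  case (Suc m)
  have "0 \<le> real m * \<delta>" using assms by simp
  then show ?case using assms Suc by (auto simp: ramp_def distrib_right min_def max_def)
qed (use assms in simp)

lemma ramp_bounds:
  assumes "0 < \<delta>"
  shows "ramp \<delta> i t \<le> \<delta>" "0 \<le> ramp \<delta> i t" "t < real i * \<delta> \<Longrightarrow> ramp \<delta> i t = 0"
    "real (Suc i) * \<delta> \<le> t \<Longrightarrow> ramp \<delta> i t = \<delta>"
  using assms by (auto simp: ramp_def algebra_simps)

text \<open>
  Bounding each ramp by the indicator of its upper threshold gives \<open>layers\<close>; bounding it by that of
  its lower threshold gives the same sum shifted by one index, so the two bounds differ by at most
  the term \<open>\<delta>\<close> of index \<open>0\<close>.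
\<close>

lemma layers_approx:
  assumes "0 < \<delta>" "0 \<le> g x" "g x \<le> real m * \<delta>"
  shows "layers g \<delta> m x \<le> g x" "g x \<le> layers g \<delta> m x + \<delta>"
proof -
  let ?a = "\<lambda>i. \<delta> * indicator {x. real i * \<delta> \<le> g x} x :: real"
  have g: "g x = (\<Sum>i<m. ramp \<delta> i (g x))" using sum_ramp[OF assms(1,2)] assms(3) by simp
  show "layers g \<delta> m x \<le> g x"
    unfolding layers_def by (subst g, intro sum_mono) (auto simp: indicator_def ramp_bounds[OF assms(1)])
  have "g x \<le> (\<Sum>i<m. ?a i)"
    by (subst g, intro sum_mono) (auto simp: indicator_def ramp_bounds[OF assms(1)] not_le)
  also have "\<dots> \<le> (\<Sum>i<Suc m. ?a i)" using assms by simp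
  also have "\<dots> = ?a 0 + layers g \<delta> m x" unfolding layers_def by (rule sum.lessThan_Suc_shift)
  also have "?a 0 = \<delta>" using assms by simp
  finally show "g x \<le> layers g \<delta> m x + \<delta>" by simp
qed

lemma simple_layers:
  assumes add: "Measure_Space.additive borel_algebra \<mu>" and g: "continuous_on UNIV g"
  shows "simple_fun (layers g \<delta> m)"
    and "simple_int \<mu> (layers g \<delta> m) = (\<Sum>i<m. \<delta> * \<mu> {x. real (Suc i) * \<delta> \<le> g x})"
proof -
  have "simple_fun (layers g \<delta> m) \<and>
      simple_int \<mu> (layers g \<delta> m) = (\<Sum>i<m. \<delta> * \<mu> {x. real (Suc i) * \<delta> \<le> g x})"
  proof (induction m)
    case 0
    have "layers g \<delta> 0 = (\<lambda>x. 0)" by (simp add: layers_def fun_eq_iff)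
    then show ?case using simple_fun_const[of 0] simple_int_const[OF add, of 0] by simp
  next
    case (Suc m)
    let ?C = "{x. real (Suc m) * \<delta> \<le> g x}"
    have C: "?C \<in> borel_algebra"
      by (intro closed_in_borel_algebra closed_Collect_le continuous_intros g)
    have eq: "layers g \<delta> (Suc m) = (\<lambda>x. layers g \<delta> m x + \<delta> * indicator ?C x)"
      by (simp add: layers_def fun_eq_iff)
    have ind: "simple_fun (\<lambda>x. \<delta> * indicator ?C x)"
      by (rule simple_fun_unop[OF simple_fun_indicator[OF C]])
    have int: "simple_int \<mu> (\<lambda>x. \<delta> * indicator ?C x) = \<delta> * \<mu> ?C"
      using simple_int_cmult[OF add simple_fun_indicator[OF C], of \<delta>] simple_int_indicator[OF add C]
      by simp
    show ?case
      unfolding eq using Suc ind int simple_int_add[OF add _ ind, of "layers g \<delta> m"]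
        simple_fun_binop[of "layers g \<delta> m" "\<lambda>x. \<delta> * indicator ?C x" "(+)"] by simp
  qed
  then show "simple_fun (layers g \<delta> m)"
    "simple_int \<mu> (layers g \<delta> m) = (\<Sum>i<m. \<delta> * \<mu> {x. real (Suc i) * \<delta> \<le> g x})" by auto
qed

context positive_functional
begin

lemma riesz_content_UNIV:
  assumes "riesz_content L \<nu>"
  shows "\<nu> UNIV = L (\<lambda>x. 1)"
  using riesz_contentD(4,5)[OF assms nonneg_bounded_cont_const[of 1], of UNIV] by simp

lemma sum:
  assumes "\<And>i. i < (m::nat) \<Longrightarrow> \<phi> i \<in> nonneg_bounded_cont"
  shows "(\<lambda>x. \<Sum>i<m. \<phi> i x) \<in> nonneg_bounded_cont \<and> L (\<lambda>x. \<Sum>i<m. \<phi> i x) = (\<Sum>i<m. L (\<phi> i))"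
  using assms
proof (induction m)
  case (Suc m)
  then show ?case using add[of "\<lambda>x. \<Sum>i<m. \<phi> i x" "\<phi> m"]
      nonneg_bounded_cont_add[of "\<lambda>x. \<Sum>i<m. \<phi> i x" "\<phi> m"] by simp
qed (simp add: zero nonneg_bounded_cont_const)

text \<open>
  The integrated form of \<open>layers_approx\<close>: a normalized ramp is \<open>1\<close> on its upper superlevel set and
  \<open>0\<close> off its lower one, so the two defining inequalities of the content enclose its value
  under \<open>L\<close>.
\<close>

lemma simple_int_layers_bounds:
  assumes \<nu>: "riesz_content L \<nu>" and \<delta>: "0 < \<delta>"
    and g: "continuous_on UNIV g" "\<And>x. 0 \<le> g x" "\<And>x. g x \<le> real m * \<delta>"
  shows "simple_int \<nu> (layers g \<delta> m) \<le> L g" "L g \<le> simple_int \<nu> (layers g \<delta> m) + \<delta> * \<nu> UNIV"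
proof -
  let ?C = "\<lambda>i. {x. real i * \<delta> \<le> g x}"
  let ?\<phi> = "\<lambda>i x. 1 / \<delta> * ramp \<delta> i (g x)"
  have add: "Measure_Space.additive borel_algebra \<nu>" and pos: "\<And>A. 0 \<le> \<nu> A"
    by (rule riesz_contentD[OF \<nu>])+
  have C: "closed (?C i)" for i
    by (intro closed_Collect_le continuous_intros g)
  have ramp: "(\<lambda>x. ramp \<delta> i (g x)) \<in> nonneg_bounded_cont" for i
  proof (rule nonneg_bounded_contI)
    show "continuous_on UNIV (\<lambda>x. ramp \<delta> i (g x))"
      unfolding ramp_def by (intro continuous_intros g)
  qed (rule ramp_bounds[OF \<delta>])+
  have \<phi>: "?\<phi> i \<in> nonneg_bounded_cont" for i
    using \<delta> by (intro nonneg_bounded_cont_scale ramp) simp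
  have L\<phi>: "L (\<lambda>x. ramp \<delta> i (g x)) = \<delta> * L (?\<phi> i)" for i
    using scale[OF ramp, of "1 / \<delta>" i] \<delta> by simp
  have lo: "\<nu> (?C (Suc i)) \<le> L (?\<phi> i)" for i
  proof -
    have "\<forall>x\<in>?C (Suc i). 1 \<le> ?\<phi> i x" using \<delta> ramp_bounds(4)[OF \<delta>] by simp
    then show ?thesis by (intro riesz_contentD(4)[OF \<nu> \<phi> C]) auto
  qed
  have hi: "L (?\<phi> i) \<le> \<nu> (?C i)" for i
  proof -
    have "\<forall>x. ?\<phi> i x \<le> 1" using \<delta> ramp_bounds(1)[OF \<delta>] by simp
    moreover have "\<forall>x. x \<notin> ?C i \<longrightarrow> ?\<phi> i x = 0" using ramp_bounds(3)[OF \<delta>] by auto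
    ultimately show ?thesis by (intro riesz_contentD(5)[OF \<nu> \<phi> C]) auto
  qed
  have "(\<Sum>i<m. ramp \<delta> i (g x)) = g x" for x
    using sum_ramp[OF \<delta> g(2)] g(3) by simp
  then have "L g = (\<Sum>i<m. L (\<lambda>x. ramp \<delta> i (g x)))"
    using sum[of m "\<lambda>i x. ramp \<delta> i (g x)"] ramp by simp
  then have Lg: "L g = (\<Sum>i<m. \<delta> * L (?\<phi> i))"
    by (simp only: L\<phi>)
  show "simple_int \<nu> (layers g \<delta> m) \<le> L g"
    unfolding simple_layers(2)[OF add g(1)] Lg using lo \<delta> by (intro sum_mono mult_left_mono) auto
  have "L g \<le> (\<Sum>i<m. \<delta> * \<nu> (?C i))"
    unfolding Lg using hi \<delta> by (intro sum_mono mult_left_mono) auto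
  also have "\<dots> \<le> (\<Sum>i<Suc m. \<delta> * \<nu> (?C i))" using \<delta> pos by simp
  also have "\<dots> = \<delta> * \<nu> (?C 0) + simple_int \<nu> (layers g \<delta> m)"
    unfolding simple_layers(2)[OF add g(1)] by (rule sum.lessThan_Suc_shift)
  also have "?C 0 = UNIV" using g(2) by auto
  finally show "L g \<le> simple_int \<nu> (layers g \<delta> m) + \<delta> * \<nu> UNIV" by simp
qed

end

section \<open>Bounded functionals as differences of positive functionals\<close>

definition bounded_cont :: "('a::topological_space \<Rightarrow> real) set"
  where "bounded_cont = {f. continuous_on UNIV f \<and> (\<exists>c. \<forall>x. \<bar>f x\<bar> \<le> c)}"

lemma bounded_contI: "continuous_on UNIV f \<Longrightarrow> (\<And>x. \<bar>f x\<bar> \<le> c) \<Longrightarrow> f \<in> bounded_cont"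
  by (auto simp: bounded_cont_def)

lemma nonneg_bounded_cont_subset: "f \<in> nonneg_bounded_cont \<Longrightarrow> f \<in> bounded_cont"
  by (auto simp: bounded_cont_def nonneg_bounded_cont_def)

lemma bounded_cont_const: "(\<lambda>x. c) \<in> bounded_cont"
  by (intro bounded_contI[where c="\<bar>c\<bar>"]) auto

lemma bounded_cont_dominated:
  assumes "f \<in> nonneg_bounded_cont" "continuous_on UNIV g" "\<And>x. \<bar>g x\<bar> \<le> f x"
  shows "g \<in> bounded_cont"
proof -
  obtain b where "\<forall>x. f x \<le> b" using assms by (auto simp: nonneg_bounded_cont_def)
  then show ?thesis using assms by (intro bounded_contI[where c=b]) (auto intro: order_trans)
qed

text \<open>
  The absolute value of \<open>F\<close> in the order dual, as a function on the positive cone.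
\<close>

definition abs_functional :: "(('a::topological_space \<Rightarrow> real) \<Rightarrow> real) \<Rightarrow> ('a \<Rightarrow> real) \<Rightarrow> real"
  where "abs_functional F f = (SUP g\<in>{g. continuous_on UNIV g \<and> (\<forall>x. \<bar>g x\<bar> \<le> f x)}. F g)"

locale bounded_functional =
  fixes F :: "('a::metric_space \<Rightarrow> real) \<Rightarrow> real" and K :: real
  assumes add: "f \<in> bounded_cont \<Longrightarrow> g \<in> bounded_cont \<Longrightarrow> F (\<lambda>x. f x + g x) = F f + F g"
    and scale: "f \<in> bounded_cont \<Longrightarrow> F (\<lambda>x. c * f x) = c * F f"
    and bound: "f \<in> bounded_cont \<Longrightarrow> (\<And>x. \<bar>f x\<bar> \<le> c) \<Longrightarrow> F f \<le> K * c"
begin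

lemma minus: "f \<in> bounded_cont \<Longrightarrow> F (\<lambda>x. - f x) = - F f"
  using scale[of f "-1"] by simp

lemma zero: "F (\<lambda>x. 0) = 0"
  using scale[OF bounded_cont_const, of 0 0] by simp

lemma abs_functional_upper:
  assumes f: "f \<in> nonneg_bounded_cont" and g: "continuous_on UNIV g" "\<And>x. \<bar>g x\<bar> \<le> f x"
  shows "F g \<le> abs_functional F f"
  unfolding abs_functional_def
proof (rule cSUP_upper)
  obtain c where c: "\<And>x. f x \<le> c" using f by (auto simp: nonneg_bounded_cont_def)
  have "F g \<le> K * c" if "continuous_on UNIV g" "\<And>x. \<bar>g x\<bar> \<le> f x" for g
    by (rule bound[OF bounded_cont_dominated[OF f that] order_trans[OF that(2) c]])
  then show "bdd_above (F ` {g. continuous_on UNIV g \<and> (\<forall>x. \<bar>g x\<bar> \<le> f x)})"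
    by (intro bdd_aboveI2) auto
qed (use g in auto)

lemma abs_functional_least:
  assumes f: "f \<in> nonneg_bounded_cont"
    and le: "\<And>g. continuous_on UNIV g \<Longrightarrow> (\<And>x. \<bar>g x\<bar> \<le> f x) \<Longrightarrow> F g \<le> c"
  shows "abs_functional F f \<le> c"
  unfolding abs_functional_def
proof (rule cSUP_least)
  have "f \<in> {g. continuous_on UNIV g \<and> (\<forall>x. \<bar>g x\<bar> \<le> f x)}"
    using f by (auto simp: nonneg_bounded_cont_def)
  then show "{g. continuous_on UNIV g \<and> (\<forall>x. \<bar>g x\<bar> \<le> f x)} \<noteq> {}" by blast
qed (use le in auto)

lemma abs_le_abs_functional:
  assumes f: "f \<in> nonneg_bounded_cont" and g: "continuous_on UNIV g" "\<And>x. \<bar>g x\<bar> \<le> f x"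
  shows "\<bar>F g\<bar> \<le> abs_functional F f"
proof -
  have "F (\<lambda>x. - g x) \<le> abs_functional F f"
    using g by (intro abs_functional_upper[OF f] continuous_intros) auto
  then show ?thesis
    using abs_functional_upper[OF f g] minus[OF bounded_cont_dominated[OF f g]] by (simp add: abs_le_iff)
qed

text \<open>
  The Riesz decomposition: clipping a function with \<open>\<bar>g\<bar> \<le> f1 + f2\<close> to the range between \<open>- f1\<close> and \<open>f1\<close>
  leaves a remainder dominated by \<open>f2\<close>. This gives subadditivity; superadditivity only needs that dominated
  functions can be added.
\<close>

lemma abs_functional_add:
  assumes f1: "f1 \<in> nonneg_bounded_cont" and f2: "f2 \<in> nonneg_bounded_cont"
  shows "abs_functional F (\<lambda>x. f1 x + f2 x) = abs_functional F f1 + abs_functional F f2"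
proof (rule antisym)
  have f: "(\<lambda>x. f1 x + f2 x) \<in> nonneg_bounded_cont" by (rule nonneg_bounded_cont_add[OF f1 f2])
  have c: "continuous_on UNIV f1" "continuous_on UNIV f2" and pos: "0 \<le> f1 x" "0 \<le> f2 x" for x
    using f1 f2 by (auto simp: nonneg_bounded_cont_def)
  show "abs_functional F (\<lambda>x. f1 x + f2 x) \<le> abs_functional F f1 + abs_functional F f2"
  proof (rule abs_functional_least[OF f])
    fix g assume g: "continuous_on UNIV g" "\<And>x. \<bar>g x\<bar> \<le> f1 x + f2 x"
    define g1 where "g1 x = max (- f1 x) (min (g x) (f1 x))" for x
    have g1: "continuous_on UNIV g1" "\<bar>g1 x\<bar> \<le> f1 x" for x
      unfolding g1_def using pos(1)[of x] by (auto intro!: continuous_intros c g)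
    have g2: "continuous_on UNIV (\<lambda>x. g x - g1 x)"
      by (intro continuous_intros g(1) g1(1))
    have g2': "\<bar>g x - g1 x\<bar> \<le> f2 x" for x
      using g(2)[of x] pos[of x] by (auto simp: g1_def)
    have "F g = F g1 + F (\<lambda>x. g x - g1 x)"
      using add[OF bounded_cont_dominated[OF f1 g1] bounded_cont_dominated[OF f2 g2 g2']] by simp
    also have "\<dots> \<le> abs_functional F f1 + abs_functional F f2"
      by (intro add_mono abs_functional_upper f1 f2 g1 g2 g2')
    finally show "F g \<le> abs_functional F f1 + abs_functional F f2" .
  qed
  have "abs_functional F f1 \<le> abs_functional F (\<lambda>x. f1 x + f2 x) - abs_functional F f2"
  proof (rule abs_functional_least[OF f1])
    fix g1 assume g1: "continuous_on UNIV g1" "\<And>x. \<bar>g1 x\<bar> \<le> f1 x"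
    have "abs_functional F f2 \<le> abs_functional F (\<lambda>x. f1 x + f2 x) - F g1"
    proof (rule abs_functional_least[OF f2])
      fix g2 assume g2: "continuous_on UNIV g2" "\<And>x. \<bar>g2 x\<bar> \<le> f2 x"
      have "F (\<lambda>x. g1 x + g2 x) \<le> abs_functional F (\<lambda>x. f1 x + f2 x)"
        using g1 g2 by (intro abs_functional_upper[OF f] continuous_intros)
          (auto intro: order_trans[OF abs_triangle_ineq] add_mono)
      then show "F g2 \<le> abs_functional F (\<lambda>x. f1 x + f2 x) - F g1"
        using add[OF bounded_cont_dominated[OF f1 g1] bounded_cont_dominated[OF f2 g2]] by simp
    qed
    then show "F g1 \<le> abs_functional F (\<lambda>x. f1 x + f2 x) - abs_functional F f2" by simp
  qed
  then show "abs_functional F f1 + abs_functional F f2 \<le> abs_functional F (\<lambda>x. f1 x + f2 x)" by simp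
qed

lemma abs_functional_scale_le:
  assumes f: "f \<in> nonneg_bounded_cont" and c: "0 < c"
  shows "c * abs_functional F f \<le> abs_functional F (\<lambda>x. c * f x)"
proof -
  have "abs_functional F f \<le> abs_functional F (\<lambda>x. c * f x) / c"
  proof (rule abs_functional_least[OF f])
    fix g assume g: "continuous_on UNIV g" "\<And>x. \<bar>g x\<bar> \<le> f x"
    have "F (\<lambda>x. c * g x) \<le> abs_functional F (\<lambda>x. c * f x)"
      using c g by (intro abs_functional_upper nonneg_bounded_cont_scale[OF f] continuous_intros)
        (auto simp: abs_mult)
    then show "F g \<le> abs_functional F (\<lambda>x. c * f x) / c"
      using scale[OF bounded_cont_dominated[OF f g]] c by (simp add: field_simps)
  qed
  then show ?thesis using c by (simp add: field_simps)
qed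

lemma abs_functional_zero: "abs_functional F (\<lambda>x. 0) = 0"
  using abs_functional_add[OF nonneg_bounded_cont_const[of 0] nonneg_bounded_cont_const[of 0]] by simp

lemma abs_functional_scale:
  assumes f: "f \<in> nonneg_bounded_cont" and c: "0 \<le> c"
  shows "abs_functional F (\<lambda>x. c * f x) = c * abs_functional F f"
proof (cases "c = 0")
  case False
  then have c: "0 < c" using c by simp
  have "1 / c * abs_functional F (\<lambda>x. c * f x) \<le> abs_functional F f"
    using abs_functional_scale_le[OF nonneg_bounded_cont_scale[OF f, of c], of "1 / c"] c by simp
  then show ?thesis using abs_functional_scale_le[OF f c] c by (simp add: field_simps)
qed (simp add: abs_functional_zero)

lemma positive_part: "positive_functional (\<lambda>f. (abs_functional F f + F f) / 2)"
proof
  fix f :: "'a \<Rightarrow> real" assume f: "f \<in> nonneg_bounded_cont"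
  then have "\<bar>F f\<bar> \<le> abs_functional F f"
    by (intro abs_le_abs_functional) (auto simp: nonneg_bounded_cont_def)
  then show "0 \<le> (abs_functional F f + F f) / 2" by simp
  show "(abs_functional F (\<lambda>x. f x + g x) + F (\<lambda>x. f x + g x)) / 2 =
      (abs_functional F f + F f) / 2 + (abs_functional F g + F g) / 2"
    if g: "g \<in> nonneg_bounded_cont" for g
    using abs_functional_add[OF f g] add[OF nonneg_bounded_cont_subset[OF f] nonneg_bounded_cont_subset[OF g]]
    by (simp add: add_divide_distrib)
  show "(abs_functional F (\<lambda>x. c * f x) + F (\<lambda>x. c * f x)) / 2 = c * ((abs_functional F f + F f) / 2)"
    if "0 \<le> c" for c
    using abs_functional_scale[OF f that] scale[OF nonneg_bounded_cont_subset[OF f]]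
    by (simp add: distrib_left)
qed

text \<open>
  The negative part of \<open>F\<close> is the positive part of \<open>- F\<close>, which has the same absolute value.
\<close>

lemma bounded_functional_minus: "bounded_functional (\<lambda>f. - F f) K"
proof
  fix f :: "'a \<Rightarrow> real" and c assume f: "f \<in> bounded_cont" and c: "\<And>x. \<bar>f x\<bar> \<le> c"
  have "F (\<lambda>x. - f x) \<le> K * c"
    using f c by (intro bound) (auto simp: bounded_cont_def intro: continuous_intros)
  then show "- F f \<le> K * c" using minus[OF f] by simp
qed (simp_all add: add scale)

lemma abs_functional_minus:
  assumes f: "f \<in> nonneg_bounded_cont"
  shows "abs_functional (\<lambda>f. - F f) f = abs_functional F f"
proof (rule antisym)
  interpret m: bounded_functional "\<lambda>f. - F f" K by (rule bounded_functional_minus)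
  show "abs_functional (\<lambda>f. - F f) f \<le> abs_functional F f"
    using abs_le_abs_functional[OF f] by (intro m.abs_functional_least[OF f]) (auto dest: abs_le_D2)
  show "abs_functional F f \<le> abs_functional (\<lambda>f. - F f) f"
    using m.abs_le_abs_functional[OF f] by (intro abs_functional_least[OF f]) (auto dest: abs_le_D1)
qed

lemma negative_part: "positive_functional (\<lambda>f. (abs_functional F f - F f) / 2)"
proof -
  interpret m: positive_functional "\<lambda>f. (abs_functional (\<lambda>f. - F f) f + - F f) / 2"
    by (rule bounded_functional.positive_part[OF bounded_functional_minus])
  show ?thesis
  proof
    fix f :: "'a \<Rightarrow> real" assume f: "f \<in> nonneg_bounded_cont"
    show "0 \<le> (abs_functional F f - F f) / 2"
      using m.nonneg[OF f] by (simp add: abs_functional_minus f)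
    show "(abs_functional F (\<lambda>x. f x + g x) - F (\<lambda>x. f x + g x)) / 2 =
        (abs_functional F f - F f) / 2 + (abs_functional F g - F g) / 2"
      if g: "g \<in> nonneg_bounded_cont" for g
      using m.add[OF f g] by (simp add: abs_functional_minus f g nonneg_bounded_cont_add)
    show "(abs_functional F (\<lambda>x. c * f x) - F (\<lambda>x. c * f x)) / 2 = c * ((abs_functional F f - F f) / 2)"
      if "0 \<le> c" for c
      using m.scale[OF f that] by (simp add: abs_functional_minus f nonneg_bounded_cont_scale that)
  qed
qed

end

section \<open>Representation of bounded functionals\<close>

lemma variation_le_sum_contents:
  assumes \<nu>: "riesz_content P \<nu>" and \<nu>': "riesz_content N \<nu>'" and A: "A \<in> borel_algebra"
  shows "variation (\<lambda>E. \<nu> E - \<nu>' E) A \<le> ennreal (\<nu> A + \<nu>' A)"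
  unfolding variation_def
proof (rule SUP_least)
  fix S assume S: "S \<in> {P. finite P \<and> P \<subseteq> borel_algebra \<and> disjoint P \<and> \<Union>P \<subseteq> A}"
  let ?m = "\<lambda>E. \<nu> E + \<nu>' E"
  note nonneg = riesz_contentD(2)[OF \<nu>] riesz_contentD(2)[OF \<nu>']
  have add: "Measure_Space.additive borel_algebra ?m"
    using riesz_contentD(1)[OF \<nu>] riesz_contentD(1)[OF \<nu>'] by (simp add: Measure_Space.additive_def)
  have U: "\<Union>S \<in> borel_algebra" using S by (intro borel_algebra.finite_Union) auto
  have disj: "disjoint_family_on (\<lambda>E. E) S"
    using S by (auto simp: disjoint_family_on_def dest: disjointD)
  have "(\<Sum>E\<in>S. ennreal \<bar>\<nu> E - \<nu>' E\<bar>) \<le> (\<Sum>E\<in>S. ennreal (?m E))"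
    using nonneg by (intro sum_mono ennreal_leI) (simp add: abs_le_iff)
  also have "\<dots> = ennreal (\<Sum>E\<in>S. ?m E)"
    using nonneg by (intro sum_ennreal) simp
  also have "(\<Sum>E\<in>S. ?m E) = ?m (\<Union>S)"
    using additive_Union_image[OF add _ _ disj] S by (auto simp: subset_iff)
  also have "?m (\<Union>S) \<le> ?m A"
    using additive_Diff[OF add U A] S nonneg(1)[of "A - \<Union>S"] nonneg(2)[of "A - \<Union>S"] by auto
  finally show "(\<Sum>E\<in>S. ennreal \<bar>\<nu> E - \<nu>' E\<bar>) \<le> ennreal (?m A)"
    by (simp add: ennreal_leI)
qed

lemma riesz_content_diff_closed_regular:
  assumes \<nu>: "riesz_content P \<nu>" and \<nu>': "riesz_content N \<nu>'"
  shows "closed_regular (\<lambda>E. \<nu> E - \<nu>' E)"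
  unfolding closed_regular_def
proof (intro ballI allI impI)
  fix A :: "'a set" and e :: real assume A: "A \<in> borel_algebra" and e: "0 < e"
  have mono: "\<nu> D \<le> \<nu> D'" "\<nu>' D \<le> \<nu>' D'"
    if "D \<in> borel_algebra" "D' \<in> borel_algebra" "D \<subseteq> D'" for D D'
    using additive_Diff[OF riesz_contentD(1)[OF \<nu>] that] riesz_contentD(2)[OF \<nu>, of "D' - D"]
      additive_Diff[OF riesz_contentD(1)[OF \<nu>'] that] riesz_contentD(2)[OF \<nu>', of "D' - D"] by auto
  obtain C U where C: "closed C" "open U" "C \<subseteq> A" "A \<subseteq> U" "\<nu> (U - C) < e / 2"
    using riesz_contentD(3)[OF \<nu> A, of "e / 2"] e by auto
  obtain C' U' where C': "closed C'" "open U'" "C' \<subseteq> A" "A \<subseteq> U'" "\<nu>' (U' - C') < e / 2"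
    using riesz_contentD(3)[OF \<nu>' A, of "e / 2"] e by auto
  let ?D = "(U \<inter> U') - (C \<union> C')"
  have alg: "?D \<in> borel_algebra" "U - C \<in> borel_algebra" "U' - C' \<in> borel_algebra"
    using C C' by (simp_all add: closed_in_borel_algebra open_in_borel_algebra borel_algebra.Diff borel_algebra.Un borel_algebra.Int)
  have "variation (\<lambda>E. \<nu> E - \<nu>' E) ?D \<le> ennreal (\<nu> ?D + \<nu>' ?D)"
    by (rule variation_le_sum_contents[OF \<nu> \<nu>' alg(1)])
  also have "\<nu> ?D + \<nu>' ?D \<le> \<nu> (U - C) + \<nu>' (U' - C')"
    by (intro add_mono mono alg) auto
  finally have "variation (\<lambda>E. \<nu> E - \<nu>' E) ?D \<le> ennreal (\<nu> (U - C) + \<nu>' (U' - C'))"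
    by (simp add: ennreal_leI)
  also have "\<dots> < ennreal e"
    using C(5) C'(5) e by (intro ennreal_lessI) auto
  finally have "variation (\<lambda>E. \<nu> E - \<nu>' E) ?D < ennreal e" .
  then show "\<exists>C U. closed C \<and> open U \<and> C \<subseteq> A \<and> A \<subseteq> U \<and> variation (\<lambda>E. \<nu> E - \<nu>' E) (U - C) < ennreal e"
    using C C' by (intro exI[of _ "C \<union> C'"] exI[of _ "U \<inter> U'"]) auto
qed

text \<open>
  Inner regularity leaves only closed sets \<open>C\<close> disjoint from \<open>B\<close>, and these lie below an Urysohn
  function that vanishes on \<open>B\<close>.
\<close>

lemma riesz_content_vanishes:
  assumes \<nu>: "riesz_content L \<nu>" and B: "closed (B :: 'a::metric_space set)"
    and L: "\<And>f. f \<in> nonneg_bounded_cont \<Longrightarrow> (\<And>x. x \<in> B \<Longrightarrow> f x = 0) \<Longrightarrow> L f = 0"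
  shows "\<nu> (UNIV - B) = 0"
proof (rule antisym[OF field_le_epsilon])
  fix e :: real assume e: "0 < e"
  have alg: "UNIV - B \<in> borel_algebra"
    by (intro borel_algebra.compl_sets closed_in_borel_algebra B)
  obtain C U where C: "closed C" "open U" "C \<subseteq> UNIV - B" "UNIV - B \<subseteq> U" "\<nu> (U - C) < e"
    using riesz_contentD(3)[OF \<nu> alg e] by blast
  obtain h :: "'a \<Rightarrow> real" where h: "continuous_on UNIV h" "\<forall>x. 0 \<le> h x \<and> h x \<le> 1"
      "\<forall>x\<in>B. h x = 0" "\<forall>x\<in>C. h x = 1"
    using Urysohn_metric[OF B C(1)] C(3) by blast
  have hc: "h \<in> nonneg_bounded_cont" using h by (intro nonneg_bounded_contI[where c=1]) auto
  have "\<nu> C \<le> L h" using h by (intro riesz_contentD(4)[OF \<nu> hc C(1)]) auto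
  also have "L h = 0" using h by (intro L hc) auto
  finally have "\<nu> C \<le> 0" .
  moreover have "\<nu> (UNIV - B) = \<nu> C + \<nu> ((UNIV - B) - C)"
    using additive_Diff[OF riesz_contentD(1)[OF \<nu>] closed_in_borel_algebra[OF C(1)] alg C(3)] by simp
  moreover have "\<nu> ((UNIV - B) - C) \<le> \<nu> (U - C)"
  proof -
    have "(UNIV - B) - C \<in> borel_algebra" "U - C \<in> borel_algebra" "(UNIV - B) - C \<subseteq> U - C"
      using C alg by (auto simp: closed_in_borel_algebra open_in_borel_algebra borel_algebra.Diff)
    from additive_Diff[OF riesz_contentD(1)[OF \<nu>] this] show ?thesis
      using riesz_contentD(2)[OF \<nu>, of "(U - C) - ((UNIV - B) - C)"] by simp
  qed
  ultimately show "\<nu> (UNIV - B) \<le> 0 + e" using C(5) by simp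
qed (rule riesz_contentD(2)[OF \<nu>])

context bounded_functional
begin

text \<open>
  The integral representation is stated as uniform approximation by simple functions with a
  quantitative error, from which both the integral and the lower bound for the variation follow.
\<close>

theorem representing_measure_exists:
  "\<exists>\<mu>. Measure_Space.additive borel_algebra \<mu> \<and> closed_regular \<mu> \<and>
    variation \<mu> UNIV = ennreal (abs_functional F (\<lambda>x. 1)) \<and>
    (\<forall>f\<in>bounded_cont. \<forall>e>0. \<exists>s. simple_fun s \<and> (\<forall>x. \<bar>s x - f x\<bar> \<le> e) \<and>
      \<bar>simple_int \<mu> s - F f\<bar> \<le> e * abs_functional F (\<lambda>x. 1)) \<and>
    (\<forall>B. closed B \<longrightarrow> (\<forall>f\<in>bounded_cont. (\<forall>x\<in>B. f x = 0) \<longrightarrow> F f = 0) \<longrightarrow> supported_on \<mu> B)"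
proof -
  let ?V = "abs_functional F"
  define P where "P f = (?V f + F f) / 2" for f
  define N where "N f = (?V f - F f) / 2" for f
  interpret P: positive_functional P unfolding P_def by (rule positive_part)
  interpret N: positive_functional N unfolding N_def by (rule negative_part)
  obtain \<nu> where \<nu>: "riesz_content P \<nu>" using P.riesz_content_exists ..
  obtain \<nu>' where \<nu>': "riesz_content N \<nu>'" using N.riesz_content_exists ..
  define \<mu> where "\<mu> E = \<nu> E - \<nu>' E" for E
  have \<mu>: "\<mu> = (\<lambda>E. \<nu> E - \<nu>' E)" by (simp add: \<mu>_def fun_eq_iff)
  let ?c = "?V (\<lambda>x. 1)"
  have tot: "\<nu> UNIV = P (\<lambda>x. 1)" "\<nu>' UNIV = N (\<lambda>x. 1)" "\<nu> UNIV + \<nu>' UNIV = ?c" "\<mu> UNIV = F (\<lambda>x. 1)"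
    using P.riesz_content_UNIV[OF \<nu>] N.riesz_content_UNIV[OF \<nu>'] by (simp_all add: P_def N_def \<mu>_def field_simps)
  note nonneg = riesz_contentD(2)[OF \<nu>] riesz_contentD(2)[OF \<nu>']
  have add\<mu>: "Measure_Space.additive borel_algebra \<mu>"
    using riesz_contentD(1)[OF \<nu>] riesz_contentD(1)[OF \<nu>'] by (simp add: Measure_Space.additive_def \<mu>_def)
  have le: "variation \<mu> UNIV \<le> ennreal ?c"
    using variation_le_sum_contents[OF \<nu> \<nu>', of UNIV] tot(3) by (simp add: \<mu>)
  then have fin: "variation \<mu> UNIV < \<infinity>" by (simp add: le_less_trans)
  have approx: "\<exists>s. simple_fun s \<and> (\<forall>x. \<bar>s x - f x\<bar> \<le> e) \<and> \<bar>simple_int \<mu> s - F f\<bar> \<le> e * ?c"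
    if f: "f \<in> bounded_cont" and e: "0 < e" for f e
  proof -
    obtain c where c: "\<And>x. \<bar>f x\<bar> \<le> c" using f by (auto simp: bounded_cont_def)
    obtain m where m: "2 * c \<le> real m * e"
      using reals_Archimedean3[OF e] by (meson less_imp_le)
    \<comment> \<open>layers are defined for nonnegative functions, so \<open>f\<close> is shifted by its bound; the shift is
      harmless because constants are integrated exactly, \<open>\<mu> UNIV = F 1\<close>\<close>
    let ?g = "\<lambda>x. f x + c"
    have cont: "continuous_on UNIV ?g"
      using f by (auto simp: bounded_cont_def intro: continuous_intros)
    have g: "0 \<le> ?g x" "?g x \<le> real m * e" for x
      using c[of x] m by (auto simp: abs_le_iff)
    have fg: "F f = F ?g - c * F (\<lambda>x. 1)"
    proof -
      have "F ?g = F f + F (\<lambda>x. c)" by (rule add[OF f bounded_cont_const])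
      moreover have "F (\<lambda>x. c * 1) = c * F (\<lambda>x. 1)" by (rule scale[OF bounded_cont_const])
      ultimately show ?thesis by simp
    qed
    have s1: "simple_fun (layers ?g e m)" by (rule simple_layers(1)[OF add\<mu> cont])
    let ?s = "\<lambda>x. layers ?g e m x - c"
    have "simple_int \<mu> ?s = simple_int \<mu> (layers ?g e m) - c * F (\<lambda>x. 1)"
      using simple_int_diff[OF add\<mu> s1 simple_fun_const[of c]] simple_int_const[OF add\<mu>, of c] tot(4) by simp
    moreover have "simple_int \<mu> (layers ?g e m) = simple_int \<nu> (layers ?g e m) - simple_int \<nu>' (layers ?g e m)"
      by (simp add: simple_int_def \<mu>_def right_diff_distrib sum_subtractf)
    moreover have "F ?g = P ?g - N ?g" by (simp add: P_def N_def field_simps)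
    moreover note P.simple_int_layers_bounds[OF \<nu> e cont g] N.simple_int_layers_bounds[OF \<nu>' e cont g]
    moreover have "e * ?c = e * \<nu> UNIV + e * \<nu>' UNIV"
      unfolding tot(3)[symmetric] by (simp add: distrib_left)
    moreover have "0 \<le> e * \<nu> UNIV" "0 \<le> e * \<nu>' UNIV" using e nonneg by auto
    ultimately have "\<bar>simple_int \<mu> ?s - F f\<bar> \<le> e * ?c" using fg by linarith
    moreover have "\<bar>?s x - f x\<bar> \<le> e" for x
      using layers_approx[where g="?g" and x=x, OF e g] e by (simp add: abs_le_iff)
    moreover have "simple_fun ?s" by (rule simple_fun_unop[OF s1])
    ultimately show ?thesis by blast
  qed
  \<comment> \<open>integration against \<open>\<mu>\<close> cannot exceed its total variation on functions bounded by \<open>1\<close>\<close>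
  have ge: "?c \<le> total_variation \<mu> UNIV"
  proof (rule abs_functional_least[OF nonneg_bounded_cont_const])
    fix g :: "'a \<Rightarrow> real" assume g: "continuous_on UNIV g" "\<And>x. \<bar>g x\<bar> \<le> 1"
    have gb: "g \<in> bounded_cont" by (rule bounded_contI[OF g])
    let ?t = "total_variation \<mu> UNIV"
    have bound: "F g \<le> ?t + e * (?t + ?c)" if e: "0 < e" for e
    proof -
      obtain s where s: "simple_fun s" "\<forall>x. \<bar>s x - g x\<bar> \<le> e" "\<bar>simple_int \<mu> s - F g\<bar> \<le> e * ?c"
        using approx[OF gb e] by blast
      note add_tv = additive_total_variation[OF add\<mu> fin]
      have sb: "\<bar>s x\<bar> \<le> 1 + e" for x using s(2)[rule_format, of x] g(2)[of x] by linarith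
      have "\<bar>simple_int \<mu> s\<bar> \<le> simple_int (total_variation \<mu>) (\<lambda>x. \<bar>s x\<bar>)"
        by (rule abs_simple_int_le[OF add\<mu> fin s(1)])
      also have "\<dots> \<le> simple_int (total_variation \<mu>) (\<lambda>x. 1 + e)"
        by (intro simple_int_mono[OF add_tv] total_variation_nonneg simple_fun_unop[OF s(1)] simple_fun_const sb)
      also have "\<dots> = (1 + e) * ?t" by (rule simple_int_const[OF add_tv])
      finally show ?thesis using s(3) by (simp add: algebra_simps abs_le_iff)
    qed
    have pos: "0 \<le> ?t + ?c" using total_variation_nonneg[of \<mu> UNIV] nonneg tot(3) by (metis add_nonneg_nonneg)
    show "F g \<le> ?t"
    proof (rule field_le_epsilon)
      fix d :: real assume d: "0 < d"
      have "d / (?t + ?c + 1) * (?t + ?c) \<le> d" using d pos by (simp add: field_simps)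
      then show "F g \<le> ?t + d" using bound[of "d / (?t + ?c + 1)"] d pos by simp
    qed
  qed simp
  have "variation \<mu> UNIV = ennreal ?c"
    using le ennreal_leI[OF ge] ennreal_total_variation[OF fin, of UNIV] by (simp add: antisym)
  moreover have "closed_regular \<mu>"
    unfolding \<mu> by (rule riesz_content_diff_closed_regular[OF \<nu> \<nu>'])
  moreover have "supported_on \<mu> B"
    if B: "closed B" "\<forall>f\<in>bounded_cont. (\<forall>x\<in>B. f x = 0) \<longrightarrow> F f = 0" for B
  proof -
    have V0: "?V f = 0" if f: "f \<in> nonneg_bounded_cont" "\<And>x. x \<in> B \<Longrightarrow> f x = 0" for f
    proof (rule antisym)
      show "?V f \<le> 0"
      proof (rule abs_functional_least[OF f(1)])
        fix g assume g: "continuous_on UNIV g" "\<And>x. \<bar>g x\<bar> \<le> f x"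
        have "g x = 0" if "x \<in> B" for x using g(2)[of x] f(2)[OF that] by simp
        then show "F g \<le> 0" using B(2) bounded_cont_dominated[OF f(1) g] by simp
      qed
      show "0 \<le> ?V f"
        using abs_functional_upper[OF f(1), of "\<lambda>x. 0"] zero f(1) by (auto simp: nonneg_bounded_cont_def)
    qed
    have F0: "F f = 0" if "f \<in> nonneg_bounded_cont" "\<And>x. x \<in> B \<Longrightarrow> f x = 0" for f
      using B(2) nonneg_bounded_cont_subset[OF that(1)] that(2) by simp
    have "\<nu> (UNIV - B) = 0" "\<nu>' (UNIV - B) = 0"
      using V0 F0 by (auto intro!: riesz_content_vanishes[OF \<nu> B(1)] riesz_content_vanishes[OF \<nu>' B(1)] simp: P_def N_def)
    then show ?thesis
      using variation_le_sum_contents[OF \<nu> \<nu>', of "UNIV - B"] borel_algebra.compl_sets[OF closed_in_borel_algebra[OF B(1)]]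
      by (simp add: supported_on_def \<mu>)
  qed
  ultimately show ?thesis using add\<mu> approx by (intro exI[of _ \<mu>] conjI ballI allI impI) auto
qed

end

section \<open>Continuous functionals\<close>

lemma \<rho>_le_iff: "0 \<le> c \<Longrightarrow> \<rho> B f \<le> ennreal c \<longleftrightarrow> (\<forall>x\<in>B. \<bar>f x\<bar> \<le> c)"
  by (simp add: \<rho>_def SUP_le_iff)

text \<open>
  A basic neighbourhood of \<open>0\<close> on which \<open>\<bar>F\<bar> < 1\<close> is given by some member of the bornology and a radius \<open>r\<close>;
  enlarging the member to a closed one shrinks the neighbourhood. Scaling \<open>f\<close> into it yields the constant
  \<open>2 / r\<close>, where the factor \<open>2\<close> accounts for the strict inequality.
\<close>

lemma dual_bounded:
  fixes \<B> :: "'a::topological_space set set"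
  assumes born: "bornology \<B>" and base: "has_closed_base \<B>" and F: "F \<in> dual \<B>"
  shows "\<exists>B\<in>\<B>. closed B \<and> (\<exists>K. \<forall>f\<in>cont_funs. \<forall>c. (\<forall>x\<in>B. \<bar>f x\<bar> \<le> c) \<longrightarrow> \<bar>F f\<bar> \<le> K * c)"
proof -
  have scale: "F (\<lambda>x. a * f x) = a * F f" if "f \<in> cont_funs" for a f
    using F that by (auto simp: dual_def)
  have zero: "(\<lambda>x. 0) \<in> cont_funs" by (simp add: cont_funs_def)
  let ?W = "{f \<in> topspace (tau \<B>). F f \<in> ball 0 1}"
  have W: "openin (tau \<B>) ?W"
    using F by (intro openin_continuous_map_preimage[where Y=euclideanreal]) (auto simp: dual_def)
  have zero_W: "(\<lambda>x. 0) \<in> ?W"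
    using scale[OF zero, of 0] zero by (simp add: topspace_tau[OF born])
  have "\<exists>A\<in>\<B>. \<exists>r>0. {g\<in>cont_funs. \<rho> A (\<lambda>x. g x - 0) < ennreal r} \<subseteq> ?W"
    by (rule W[unfolded openin_tau[OF born], THEN conjunct2, THEN bspec, OF zero_W])
  then obtain A r where A: "A \<in> \<B>" and r: "0 < r"
      and W: "{g\<in>cont_funs. \<rho> A (\<lambda>x. g x - 0) < ennreal r} \<subseteq> ?W"
    by blast
  obtain B where B: "B \<in> \<B>" "closed B" "A \<subseteq> B"
    using base A by (auto simp: has_closed_base_def)
  have nonempty: "B \<noteq> {}" using born B(1) by (auto simp: bornology_def)
  have "\<bar>F f\<bar> \<le> 2 / r * c" if f: "f \<in> cont_funs" and c: "\<forall>x\<in>B. \<bar>f x\<bar> \<le> c" for f c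
  proof (rule field_le_epsilon)
    fix e :: real assume e: "0 < e"
    obtain b where "b \<in> B" using nonempty by blast
    then have c0: "0 \<le> c" using c abs_ge_zero[of "f b"] by (blast intro: order_trans)
    \<comment> \<open>a strictly positive bound is needed for scaling, and \<open>2 / r * a = 2 / r * c + e\<close>\<close>
    define a where "a = c + r / 2 * e"
    have a: "0 < a" "c \<le> a" using c0 e r by (simp_all add: a_def add_nonneg_pos)
    let ?g = "\<lambda>x. r / (2 * a) * f x"
    have g: "?g \<in> cont_funs"
      unfolding cont_funs_def using f by (intro CollectI continuous_intros) (simp add: cont_funs_def)
    have "\<bar>?g x\<bar> \<le> r / 2" if "x \<in> A" for x
    proof -
      have "\<bar>f x\<bar> \<le> c" using c that B(3) by blast
      then have "\<bar>f x\<bar> \<le> a" using a(2) by simp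
      then have "r / (2 * a) * \<bar>f x\<bar> \<le> r / (2 * a) * a" using a r by (intro mult_left_mono) auto
      then show ?thesis using a r by (simp add: abs_mult)
    qed
    then have "\<rho> A (\<lambda>x. ?g x - 0) \<le> ennreal (r / 2)" using r by (subst \<rho>_le_iff) auto
    also have "\<dots> < ennreal r" using r by (intro ennreal_lessI) auto
    finally have "?g \<in> ?W" using W g by blast
    then have "\<bar>F ?g\<bar> < 1" by (simp add: dist_real_def)
    then have "\<bar>r / (2 * a) * F f\<bar> < 1" by (simp only: scale[OF f])
    then have "\<bar>F f\<bar> < 2 / r * a" using a r by (simp add: abs_mult field_simps)
    also have "2 / r * a = 2 / r * c + e" using r by (simp add: a_def field_simps)
    finally show "\<bar>F f\<bar> \<le> 2 / r * c + e" by simp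
  qed
  then show ?thesis using B by blast
qed

text \<open>
  The function \<open>f\<close> may be unbounded off \<open>B\<close>, where no sequence of simple functions approaches it uniformly.
  Approximating a bounded \<open>g\<close> that agrees with \<open>f\<close> on \<open>B\<close> suffices, since convergence in measure ignores
  the complement of \<open>B\<close>.
\<close>

lemma has_ds_integral_uniform_limit:
  assumes add: "Measure_Space.additive borel_algebra \<mu>" and fin: "variation \<mu> UNIV < \<infinity>"
    and B: "closed B" "supported_on \<mu> B" and fg: "\<And>x. x \<in> B \<Longrightarrow> f x = g x"
    and s: "\<And>n. simple_fun (s n)" "\<And>n x. \<bar>s n x - g x\<bar> \<le> 1 / real (Suc n)"
    and I: "(\<lambda>n. simple_int \<mu> (s n)) \<longlonglongrightarrow> I"
  shows "has_ds_integral \<mu> f I"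
  unfolding has_ds_integral_def
proof (intro exI[of _ s] conjI allI impI s(1) I)
  fix e :: real assume e: "0 < e"
  obtain N where N: "1 / real (Suc N) < e"
    using e by (rule nat_approx_posE)
  have "outer_variation \<mu> {x. \<bar>s n x - f x\<bar> > e} = 0" if n: "N \<le> n" for n
  proof -
    have "1 / real (Suc n) \<le> 1 / real (Suc N)" using n by (intro divide_left_mono) auto
    then have "\<bar>s n x - g x\<bar> \<le> e" for x using s(2)[of n x] N by linarith
    then have "\<not> e < \<bar>s n x - f x\<bar>" if "x \<in> B" for x
      unfolding fg[OF that] not_less .
    then have "{x. \<bar>s n x - f x\<bar> > e} \<subseteq> UNIV - B" by blast
    then have "outer_variation \<mu> {x. \<bar>s n x - f x\<bar> > e} \<le> variation \<mu> (UNIV - B)"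
      by (intro outer_variation_le borel_algebra.compl_sets closed_in_borel_algebra B)
    then show ?thesis using B(2) by (simp add: supported_on_def)
  qed
  then show "(\<lambda>n. outer_variation \<mu> {x. \<bar>s n x - f x\<bar> > e}) \<longlonglongrightarrow> 0"
    by (intro tendsto_eventually eventually_sequentiallyI)
next
  fix e :: real assume e: "0 < e"
  have tv: "(\<lambda>A. enn2real (variation \<mu> A)) = total_variation \<mu>"
    by (simp add: total_variation_def fun_eq_iff)
  let ?v = "total_variation \<mu> UNIV"
  note add_tv = additive_total_variation[OF add fin]
  have v: "0 \<le> ?v" by (rule total_variation_nonneg)
  have "0 < e / (2 * (?v + 1))" using e v by simp
  then obtain N where N: "1 / real (Suc N) < e / (2 * (?v + 1))" by (rule nat_approx_posE)
  have "simple_int (total_variation \<mu>) (\<lambda>x. \<bar>s m x - s n x\<bar>) < e" if mn: "N \<le> m" "N \<le> n" for m n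
  proof -
    let ?d = "2 * (1 / real (Suc N))"
    have "\<bar>s m x - s n x\<bar> \<le> ?d" for x
    proof -
      have "1 / real (Suc m) \<le> 1 / real (Suc N)" "1 / real (Suc n) \<le> 1 / real (Suc N)"
        using mn by (auto intro: divide_left_mono)
      then show ?thesis using s(2)[of m x] s(2)[of n x] by linarith
    qed
    then have "simple_int (total_variation \<mu>) (\<lambda>x. \<bar>s m x - s n x\<bar>) \<le> simple_int (total_variation \<mu>) (\<lambda>x. ?d)"
      by (intro simple_int_mono[OF add_tv] total_variation_nonneg simple_fun_const
          simple_fun_binop[OF s(1) s(1), of "\<lambda>a b. \<bar>a - b\<bar>"])
    also have "\<dots> = ?d * ?v" by (rule simple_int_const[OF add_tv])
    also have "\<dots> \<le> ?d * (?v + 1)" by (intro mult_left_mono) auto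
    also have "\<dots> < e" using N v by (simp add: field_simps)
    finally show ?thesis .
  qed
  then show "\<exists>N. \<forall>m\<ge>N. \<forall>n\<ge>N. simple_int (\<lambda>A. enn2real (variation \<mu> A)) (\<lambda>x. \<bar>s m x - s n x\<bar>) < e"
    unfolding tv by blast
qed

lemma lin_subspace_diff:
  assumes U: "lin_subspace U" and u: "u \<in> U" and u': "u' \<in> U"
  shows "(\<lambda>x. u x - u' x) \<in> U"
proof -
  have add: "\<forall>f\<in>U. \<forall>g\<in>U. (\<lambda>x. f x + g x) \<in> U" and scale: "\<forall>c. \<forall>f\<in>U. (\<lambda>x. c * f x) \<in> U"
    using U by (simp_all add: lin_subspace_def)
  have "(\<lambda>x. u x + -1 * u' x) \<in> U"
    using add[THEN bspec, OF u, THEN bspec, OF scale[THEN spec, THEN bspec, OF u']] .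
  then show ?thesis by simp
qed

lemma direct_sum_of_unique:
  assumes "direct_sum_of V U W" "u \<in> U" "w \<in> W" "u' \<in> U" "w' \<in> W"
    and eq: "\<And>x. u x + w x = u' x + w' x"
  shows "u = u'" "w = w'"
proof -
  have U: "lin_subspace U" and W: "lin_subspace W" and int: "U \<inter> W = {\<lambda>x. 0}"
    using assms(1) by (auto simp: direct_sum_of_def)
  have "(\<lambda>x. u x - u' x) \<in> U" by (rule lin_subspace_diff[OF U assms(2,4)])
  moreover have "(\<lambda>x. w' x - w x) \<in> W" by (rule lin_subspace_diff[OF W assms(5,3)])
  moreover have "w' x - w x = u x - u' x" for x using eq[of x] by simp
  ultimately have "(\<lambda>x. u x - u' x) \<in> U \<inter> W" by simp
  then have "(\<lambda>x. u x - u' x) = (\<lambda>x. 0)" unfolding int by simp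
  then have "u x = u' x" for x by (auto dest!: fun_cong[of _ _ x])
  then show "u = u'" "w = w'" using eq by (auto simp: fun_eq_iff)
qed

lemma proj_along_sum:
  assumes ds: "direct_sum_of V U W" and u: "u \<in> U" and w: "w \<in> W"
  shows "proj_along U W (\<lambda>x. u x + w x) = u" "proj_along W U (\<lambda>x. u x + w x) = w"
proof -
  show "proj_along U W (\<lambda>x. u x + w x) = u"
    unfolding proj_along_def
  proof (rule the_equality)
    fix u' assume "u' \<in> U \<and> (\<exists>w'\<in>W. (\<lambda>x. u x + w x) = (\<lambda>x. u' x + w' x))"
    then obtain w' where "u' \<in> U" "w' \<in> W" "\<And>x. u x + w x = u' x + w' x"
      by (auto simp: fun_eq_iff)
    then show "u' = u" using direct_sum_of_unique(1)[OF ds u w, of u' w'] by simp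
  qed (use u w in auto)
  show "proj_along W U (\<lambda>x. u x + w x) = w"
    unfolding proj_along_def
  proof (rule the_equality)
    show "w \<in> W \<and> (\<exists>u'\<in>U. (\<lambda>x. u x + w x) = (\<lambda>x. w x + u' x))"
      using u w by (auto simp: add.commute)
    fix w' assume "w' \<in> W \<and> (\<exists>u'\<in>U. (\<lambda>x. u x + w x) = (\<lambda>x. w' x + u' x))"
    then obtain u' where "w' \<in> W" "u' \<in> U" "\<And>x. u x + w x = u' x + w' x"
      by (auto simp: fun_eq_iff add.commute)
    then show "w' = w" using direct_sum_of_unique(2)[OF ds u w, of u' w'] by simp
  qed
qed

theorem theorem2p10:
  fixes \<B> :: "'a::metric_space set set"
    and F :: "('a \<Rightarrow> real) \<Rightarrow> real"
    and M :: "'a set \<Rightarrow> ('a \<Rightarrow> real) set"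
  assumes "bornology \<B>"
    and "has_closed_base \<B>"
    and "\<And>B. B \<in> \<B> \<Longrightarrow> direct_sum_of cont_funs (cont_fin B) (M B)"
    and "F \<in> dual \<B>"
  shows "\<exists>B\<in>\<B>. closed B \<and> (\<exists>\<mu>\<in>bornological_measures \<B>. supported_on \<mu> B \<and>
    (\<forall>f\<in>cont_funs. F f = H \<mu> (proj_along (cont_fin B) (M B) f)
                          + F (proj_along (M B) (cont_fin B) f)) \<and>
    (\<forall>f\<in>cont_fin B. has_ds_integral \<mu> f (F f)) \<and>
    variation \<mu> UNIV = (SUP f\<in>{f\<in>cont_funs. sup_norm f \<le> 1}. ennreal \<bar>F f\<bar>))"
proof -
  obtain B K where B: "B \<in> \<B>" "closed B"
    and K: "\<And>f c. f \<in> cont_funs \<Longrightarrow> (\<And>x. x \<in> B \<Longrightarrow> \<bar>f x\<bar> \<le> c) \<Longrightarrow> \<bar>F f\<bar> \<le> K * c"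
    using dual_bounded[OF assms(1,2,4)] by blast
  have F_add: "F (\<lambda>x. f x + g x) = F f + F g" if "f \<in> cont_funs" "g \<in> cont_funs" for f g
    using assms(4) that by (auto simp: dual_def)
  have F_scale: "F (\<lambda>x. c * f x) = c * F f" if "f \<in> cont_funs" for f c
    using assms(4) that by (auto simp: dual_def)
  have F_local: "F f = F g" if f: "f \<in> cont_funs" and g: "g \<in> cont_funs" and eq: "\<And>x. x \<in> B \<Longrightarrow> f x = g x" for f g
  proof -
    have ng: "(\<lambda>x. -1 * g x) \<in> cont_funs" using g by (auto simp: cont_funs_def intro: continuous_intros)
    have d: "(\<lambda>x. f x + -1 * g x) \<in> cont_funs" using f g by (auto simp: cont_funs_def intro: continuous_intros)
    have "\<bar>F (\<lambda>x. f x + -1 * g x)\<bar> \<le> K * 0" using eq by (intro K d) simp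
    then show ?thesis using F_add[OF f ng] F_scale[OF g, of "-1"] by simp
  qed
  have cont: "f \<in> cont_funs" if "f \<in> bounded_cont" for f :: "'a \<Rightarrow> real"
    using that by (auto simp: bounded_cont_def cont_funs_def)
  interpret bounded_functional F K
  proof
    show "F f \<le> K * c" if "f \<in> bounded_cont" "\<And>x. \<bar>f x\<bar> \<le> c" for f c
      using K[OF cont[OF that(1)] that(2)] by simp
  qed (auto intro: F_add F_scale cont)
  let ?V = "abs_functional F (\<lambda>x. 1)"
  obtain \<mu> where \<mu>: "Measure_Space.additive borel_algebra \<mu>" "closed_regular \<mu>" "variation \<mu> UNIV = ennreal ?V"
    and approx: "\<forall>f\<in>bounded_cont. \<forall>e>0. \<exists>s. simple_fun s \<and> (\<forall>x. \<bar>s x - f x\<bar> \<le> e) \<and>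
      \<bar>simple_int \<mu> s - F f\<bar> \<le> e * ?V"
    and supp: "\<forall>B. closed B \<longrightarrow> (\<forall>f\<in>bounded_cont. (\<forall>x\<in>B. f x = 0) \<longrightarrow> F f = 0) \<longrightarrow> supported_on \<mu> B"
    using representing_measure_exists by (elim exE conjE) (rule that)
  have fin: "variation \<mu> UNIV < \<infinity>" using \<mu>(3) by simp
  have \<mu>B: "supported_on \<mu> B"
  proof (rule supp[THEN spec, THEN mp, OF B(2), THEN mp], intro ballI impI)
    fix f :: "'a \<Rightarrow> real" assume "f \<in> bounded_cont" "\<forall>x\<in>B. f x = 0"
    then show "F f = 0" using F_local[of f "\<lambda>x. 0"] cont zero by (simp add: cont_funs_def)
  qed
  have mem: "\<mu> \<in> bornological_measures \<B>"
    using \<mu> fin B \<mu>B by (auto simp: bornological_measures_def)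
  have int: "has_ds_integral \<mu> f (F f)" if f: "f \<in> cont_fin B" for f
  proof -
    have fc: "f \<in> cont_funs" and "\<rho> B f < top" using f by (auto simp: cont_fin_def)
    then obtain c where c: "0 \<le> c" "\<rho> B f = ennreal c" by (cases "\<rho> B f") auto
    have cB: "\<forall>x\<in>B. \<bar>f x\<bar> \<le> c" using \<rho>_le_iff[OF c(1), of B f] c(2) by simp
    \<comment> \<open>truncation makes \<open>f\<close> bounded on the whole space and changes nothing on \<open>B\<close>\<close>
    let ?g = "\<lambda>x. max (- c) (min (f x) c)"
    have g: "?g \<in> bounded_cont"
      using fc c(1) by (intro bounded_contI[where c=c] continuous_intros) (auto simp: cont_funs_def)
    have fg: "f x = ?g x" if "x \<in> B" for x using cB that by (auto simp: abs_le_iff)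
    have "\<exists>s. simple_fun s \<and> (\<forall>x. \<bar>s x - ?g x\<bar> \<le> 1 / real (Suc n)) \<and> \<bar>simple_int \<mu> s - F ?g\<bar> \<le> 1 / real (Suc n) * ?V" for n
      by (rule approx[rule_format, OF g]) simp
    then obtain s where s: "\<And>n. simple_fun (s n)" "\<And>n x. \<bar>s n x - ?g x\<bar> \<le> 1 / real (Suc n)"
        "\<And>n. \<bar>simple_int \<mu> (s n) - F ?g\<bar> \<le> 1 / real (Suc n) * ?V"
      by metis
    have lim: "(\<lambda>n. simple_int \<mu> (s n)) \<longlonglongrightarrow> F ?g"
    proof (rule LIM_zero_cancel, rule Lim_null_comparison)
      show "\<forall>\<^sub>F n in sequentially. norm (simple_int \<mu> (s n) - F ?g) \<le> 1 / real (Suc n) * ?V"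
        using s(3) by simp
      show "(\<lambda>n. 1 / real (Suc n) * ?V) \<longlonglongrightarrow> 0"
        using tendsto_mult_right[OF LIMSEQ_inverse_real_of_nat, of ?V] by (simp add: inverse_eq_divide)
    qed
    have "has_ds_integral \<mu> f (F ?g)"
    proof (rule has_ds_integral_uniform_limit[where f=f and g="?g" and s=s, OF \<mu>(1) fin B(2) \<mu>B _ s(1,2) lim])
      show "f x = ?g x" if "x \<in> B" for x by (rule fg[OF that])
    qed
    then show ?thesis by (simp only: F_local[OF fc cont[OF g] fg])
  qed
  have H: "H \<mu> f = F f" if "f \<in> cont_fin B" for f
    unfolding H_def
  proof (rule the_equality)
    show "has_ds_integral \<mu> f (F f)" by (rule int[OF that])
    show "I = F f" if I: "has_ds_integral \<mu> f I" for I
      by (rule has_ds_integral_unique[OF \<mu>(1) fin I int[OF \<open>f \<in> cont_fin B\<close>]])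
  qed
  have split: "F f = H \<mu> (proj_along (cont_fin B) (M B) f) + F (proj_along (M B) (cont_fin B) f)"
    if f: "f \<in> cont_funs" for f
  proof -
    note ds = assms(3)[OF B(1)]
    have V: "cont_funs = {(\<lambda>x. u x + w x) | u w. u \<in> cont_fin B \<and> w \<in> M B}"
      and "lin_subspace (cont_fin B)"
      by (rule ds[unfolded direct_sum_of_def, THEN conjunct2, THEN conjunct2, THEN conjunct1]
          ds[unfolded direct_sum_of_def, THEN conjunct1])+
    then have zero_fin: "(\<lambda>x. 0) \<in> cont_fin B" by (simp add: lin_subspace_def)
    have "f \<in> {(\<lambda>x. u x + w x) | u w. u \<in> cont_fin B \<and> w \<in> M B}" by (rule f[unfolded V])
    then obtain u w where uw: "u \<in> cont_fin B" "w \<in> M B" "f = (\<lambda>x. u x + w x)"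
      by (elim CollectE exE conjE)
    have "w \<in> cont_funs"
      unfolding V using zero_fin uw(2) by (intro CollectI exI[of _ "\<lambda>x. 0"] exI[of _ w]) simp
    moreover have "u \<in> cont_funs" using uw(1) by (simp add: cont_fin_def)
    ultimately have "F f = F u + F w" unfolding uw(3) by (intro F_add) simp_all
    then show ?thesis
      using proj_along_sum[OF ds uw(1,2)] H[OF uw(1)] unfolding uw(3) by simp
  qed
  have norm: "ennreal ?V = (SUP f\<in>{f\<in>cont_funs. sup_norm f \<le> 1}. ennreal \<bar>F f\<bar>)" (is "_ = ?S")
  proof (rule antisym)
    have unit: "sup_norm f \<le> 1 \<longleftrightarrow> (\<forall>x. \<bar>f x\<bar> \<le> 1)" for f :: "'a \<Rightarrow> real"
      using \<rho>_le_iff[of 1 UNIV f] by simp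
    note one = nonneg_bounded_cont_const[of 1, simplified]
    show le: "?S \<le> ennreal ?V"
    proof (rule SUP_least)
      fix f :: "'a \<Rightarrow> real" assume "f \<in> {f\<in>cont_funs. sup_norm f \<le> 1}"
      then have "\<bar>F f\<bar> \<le> ?V"
        by (intro abs_le_abs_functional[OF one]) (auto simp: unit cont_funs_def)
      then show "ennreal \<bar>F f\<bar> \<le> ennreal ?V" by (rule ennreal_leI)
    qed
    then have S: "?S < top" by (simp add: le_less_trans)
    have "?V \<le> enn2real ?S"
    proof (rule abs_functional_least[OF one])
      fix g :: "'a \<Rightarrow> real" assume g: "continuous_on UNIV g" "\<And>x. \<bar>g x\<bar> \<le> 1"
      then have "ennreal \<bar>F g\<bar> \<le> ?S" by (intro SUP_upper) (simp add: unit cont_funs_def)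
      then have "\<bar>F g\<bar> \<le> enn2real ?S" using enn2real_mono[OF _ S] by fastforce
      then show "F g \<le> enn2real ?S" by simp
    qed
    then have "ennreal ?V \<le> ennreal (enn2real ?S)" by (rule ennreal_leI)
    then show "ennreal ?V \<le> ?S" using S by simp
  qed
  show ?thesis
  proof (intro bexI[of _ B] bexI[of _ \<mu>] conjI ballI)
    show "variation \<mu> UNIV = (SUP f\<in>{f\<in>cont_funs. sup_norm f \<le> 1}. ennreal \<bar>F f\<bar>)"
      using \<mu>(3) norm by (rule trans)
  qed (fact B mem \<mu>B | rule split int; assumption)+
qed

end
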